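(* Let $H$ be a Hilbert space and let $t\mapsto A(t)$, $t\in\mathbb{R}$, be a curve of unbounded self-adjoint operators in $H$ with common domain of definition $V$ and with compact resolvent. Suppose that at least one of the following holds: (i) $A$ is a $C^{1,\alpha}$ curve for some $\alpha>0$; (ii) the resolvent $(t,z)\mapsto (A(t)-z)^{-1}$ is $C^1$ into $L(H,H)$ in $t$ and $z$ jointly. Let $(\lambda_i)$ be any sequence of continuous functions $\lambda_i:\mathbb{R}\to\mathbb{R}$ which parameterizes all eigenvalues of $A(t)$, $t\in\mathbb{R}$. Then each function $\lambda_i$ has a right-sided derivative $\lambda_i^{(+)}(t)$ and a left-sided derivative $\lambda_i^{(-)}(t)$ at each $t\in\mathbb{R}$, and for each $t\in\mathbb{R}$ and $z\in\mathbb{R}$ the set $\{\lambda_i^{(+)}(t):\lambda_i(t)=z\}$ equals $\{\lambda_i^{(-)}(t):\lambda_i(t)=z\}$ with correct multiplicities (i.e. they agree as multisets indexed by $\{i:\lambda_i(t)=z\}$).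
   Context: $H$ is a complex Hilbert space and $L(H,H)$ is the Banach space of bounded linear operators on $H$. A curve $t\mapsto A(t)$, $t\in\mathbb{R}$, of unbounded self-adjoint operators in $H$ with common domain: there is a dense linear subspace $V\subseteq H$ which is the domain of definition of each $A(t)$, and $A(t)^*=A(t)$ for each $t$. A function $f$ of a real variable is called $C^{1,\alpha}$ if it is differentiable and the expression $\frac{f'(t)-f'(s)}{|t-s|^\alpha}$ is locally bounded in $t\neq s$. The curve $A$ is called $C^{1,\alpha}$ if for each $u\in V$ and $v\in H$ the function $t\mapsto\langle A(t)u,v\rangle$ is $C^{1,\alpha}$. The resolvent is considered on its natural domain $\{(t,z)\in\mathbb{R}\times\mathbb{C}: A(t)-z:V\to H\text{ is invertible}\}$. Compact resolvent: for each $t$, the operator $(A(t)-z)^{-1}:H\to H$ is compact for some (equivalently any) $z$ in the resolvent set of $A(t)$. A (finite or infinite) sequence of functions $\lambda_i:\mathbb{R}\to\mathbb{R}$ is said to parameterize the eigenvalues of $A(t)$ if for each $t\in\mathbb{R}$ and each $z\in\mathbb{R}$ the cardinality $|\{i:\lambda_i(t)=z\}|$ equals the multiplicity of $z$ as an eigenvalue of $A(t)$ (multiplicity $0$ if $z$ is not an eigenvalue). *)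

theory Defs
  imports "HOL-Analysis.Analysis" "HOL-Library.Equipollence" "HOL-Library.Extended_Nat"
begin

section \<open>Complex Hilbert spaces\<close>

text \<open>
  The inner product \<open>cinner\<close> is linear in its first argument. Its real part is the real inner
  product of the underlying real Hilbert space; together with the axioms of \<open>real_inner\<close> this gives
  positive definiteness and \<open>norm x = sqrt (Re (cinner x x))\<close>.
\<close>

class complex_hilbert_space = real_inner + complete_space +
  fixes scaleC :: "complex \<Rightarrow> 'a \<Rightarrow> 'a" (infixr "*\<^sub>C" 75)
    and cinner :: "'a \<Rightarrow> 'a \<Rightarrow> complex"
  assumes scaleC_add_right: "c *\<^sub>C (x + y) = c *\<^sub>C x + c *\<^sub>C y"
    and scaleC_add_left: "(c + d) *\<^sub>C x = c *\<^sub>C x + d *\<^sub>C x"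
    and scaleC_scaleC: "c *\<^sub>C (d *\<^sub>C x) = (c * d) *\<^sub>C x"
    and scaleC_of_real: "complex_of_real r *\<^sub>C x = r *\<^sub>R x"
    and cinner_commute: "cinner x y = cnj (cinner y x)"
    and cinner_add_left: "cinner (x + y) z = cinner x z + cinner y z"
    and cinner_scaleC_left: "cinner (c *\<^sub>C x) y = c * cinner x y"
    and Re_cinner: "Re (cinner x y) = inner x y"

instantiation complex :: complex_hilbert_space
begin

definition scaleC_complex :: "complex \<Rightarrow> complex \<Rightarrow> complex"
  where "scaleC_complex c x = c * x"

definition cinner_complex :: "complex \<Rightarrow> complex \<Rightarrow> complex"
  where "cinner_complex x y = x * cnj y"

instance
  by standard
    (auto simp: scaleC_complex_def cinner_complex_def algebra_simps scaleR_conv_of_real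
      inner_complex_def)

end

global_interpretation cvec: vector_space "scaleC :: complex \<Rightarrow> 'a \<Rightarrow> 'a::complex_hilbert_space"
proof
  fix x :: 'a
  show "1 *\<^sub>C x = x"
    using scaleC_of_real[of 1 x] by simp
qed (simp_all add: scaleC_add_right scaleC_add_left scaleC_scaleC)


section \<open>Unbounded self-adjoint operators\<close>

text \<open>
  An unbounded operator with domain \<open>V\<close> is represented by a total function \<open>T\<close> of which only the
  values on \<open>V\<close> are ever used.
\<close>

definition densely_defined_operator :: "'a::complex_hilbert_space set \<Rightarrow> ('a \<Rightarrow> 'a) \<Rightarrow> bool"
  where "densely_defined_operator V T \<longleftrightarrow>
    cvec.subspace V \<and> closure V = UNIV \<and>
    (\<forall>x\<in>V. \<forall>y\<in>V. T (x + y) = T x + T y) \<and>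
    (\<forall>c. \<forall>x\<in>V. T (c *\<^sub>C x) = c *\<^sub>C T x)"

definition adjoint_graph :: "'a::complex_hilbert_space set \<Rightarrow> ('a \<Rightarrow> 'a) \<Rightarrow> ('a \<times> 'a) set"
  where "adjoint_graph V T = {(y, w). \<forall>x\<in>V. cinner (T x) y = cinner x w}"

definition self_adjoint_operator :: "'a::complex_hilbert_space set \<Rightarrow> ('a \<Rightarrow> 'a) \<Rightarrow> bool"
  where "self_adjoint_operator V T \<longleftrightarrow>
    densely_defined_operator V T \<and> adjoint_graph V T = {(y, T y) | y. y \<in> V}"

definition resolvent_set :: "'a::complex_hilbert_space set \<Rightarrow> ('a \<Rightarrow> 'a) \<Rightarrow> complex set"
  where "resolvent_set V T =
    {z. bij_betw (\<lambda>x. T x - z *\<^sub>C x) V UNIV \<and> bounded_linear (inv_into V (\<lambda>x. T x - z *\<^sub>C x))}"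

text \<open>
  Bounded operators are taken from the type of bounded real-linear maps with the operator norm. The
  bounded complex-linear maps form a closed subspace, which contains the values of the resolvent,
  so that continuity and differentiability have the same meaning in both spaces.
\<close>

definition resolvent :: "'a::complex_hilbert_space set \<Rightarrow> ('a \<Rightarrow> 'a) \<Rightarrow> complex \<Rightarrow> 'a \<Rightarrow>\<^sub>L 'a"
  where "resolvent V T z = Blinfun (inv_into V (\<lambda>x. T x - z *\<^sub>C x))"

definition compact_operator :: "('a::real_normed_vector \<Rightarrow>\<^sub>L 'b::real_normed_vector) \<Rightarrow> bool"
  where "compact_operator K \<longleftrightarrow> (\<forall>B. bounded B \<longrightarrow> compact (closure (blinfun_apply K ` B)))"

definition has_compact_resolvent :: "'a::complex_hilbert_space set \<Rightarrow> ('a \<Rightarrow> 'a) \<Rightarrow> bool"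
  where "has_compact_resolvent V T \<longleftrightarrow> (\<exists>z\<in>resolvent_set V T. compact_operator (resolvent V T z))"

definition eigenspace :: "'a::complex_hilbert_space set \<Rightarrow> ('a \<Rightarrow> 'a) \<Rightarrow> complex \<Rightarrow> 'a set"
  where "eigenspace V T z = {x \<in> V. T x = z *\<^sub>C x}"


section \<open>Regularity of curves of operators\<close>

text \<open>
  Local boundedness of the difference quotient refers to all of the plane with the diagonal removed,
  including neighbourhoods of diagonal points: the quotient is bounded on every compact square,
  minus the diagonal.
\<close>

definition C1_Holder :: "real \<Rightarrow> (real \<Rightarrow> 'b::real_normed_vector) \<Rightarrow> bool"
  where "C1_Holder \<alpha> f \<longleftrightarrow>
    (\<exists>f'. (\<forall>t. (f has_vector_derivative f' t) (at t)) \<and>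
      (\<forall>a b. bounded {(f' t - f' s) /\<^sub>R (\<bar>t - s\<bar> powr \<alpha>) | t s.
        t \<in> {a..b} \<and> s \<in> {a..b} \<and> t \<noteq> s}))"

definition C1_Holder_curve ::
    "real \<Rightarrow> 'a::complex_hilbert_space set \<Rightarrow> (real \<Rightarrow> 'a \<Rightarrow> 'a) \<Rightarrow> bool"
  where "C1_Holder_curve \<alpha> V A \<longleftrightarrow> (\<forall>u\<in>V. \<forall>v. C1_Holder \<alpha> (\<lambda>t. cinner (A t u) v))"

definition global_resolvent_set ::
    "'a::complex_hilbert_space set \<Rightarrow> (real \<Rightarrow> 'a \<Rightarrow> 'a) \<Rightarrow> (real \<times> complex) set"
  where "global_resolvent_set V A = {(t, z). z \<in> resolvent_set V (A t)}"

text \<open>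
  Differentiability is in the real (Frechet) sense in \<open>(t, z)\<close>. The derivative is taken within the
  natural domain, so that openness of this domain is not presupposed: it contains all \<open>(t, z)\<close> with
  nonreal \<open>z\<close>, and norm continuity of the resolvent there already makes it open.
\<close>

definition C1_resolvent :: "'a::complex_hilbert_space set \<Rightarrow> (real \<Rightarrow> 'a \<Rightarrow> 'a) \<Rightarrow> bool"
  where "C1_resolvent V A \<longleftrightarrow>
    (\<exists>R' :: real \<times> complex \<Rightarrow> (real \<times> complex) \<Rightarrow>\<^sub>L ('a \<Rightarrow>\<^sub>L 'a).
      (\<forall>p\<in>global_resolvent_set V A.
        ((\<lambda>(t, z). resolvent V (A t) z) has_derivative blinfun_apply (R' p))
          (at p within global_resolvent_set V A)) \<and>
      continuous_on (global_resolvent_set V A) R')"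


section \<open>Parameterizations of the eigenvalues\<close>

text \<open>
  A finite or infinite sequence is a function on \<open>nat\<close> of which only the values at indices
  \<open>i\<close> with \<open>enat i < N\<close> are used; \<open>N = \<infinity>\<close> for an infinite sequence. Cardinalities are compared by
  equipollence, because \<open>card\<close> and the library dimension are 0 in the infinite case.
\<close>

definition parameterizes_eigenvalues ::
    "enat \<Rightarrow> (nat \<Rightarrow> real \<Rightarrow> real) \<Rightarrow> 'a::complex_hilbert_space set \<Rightarrow> (real \<Rightarrow> 'a \<Rightarrow> 'a) \<Rightarrow> bool"
  where "parameterizes_eigenvalues N l V A \<longleftrightarrow>
    (\<forall>t z. \<exists>B. cvec.independent B \<and> cvec.span B = eigenspace V (A t) (complex_of_real z) \<and>
      {i. enat i < N \<and> l i t = z} \<approx> B)"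

definition same_multiset_on :: "'i set \<Rightarrow> ('i \<Rightarrow> 'b) \<Rightarrow> ('i \<Rightarrow> 'b) \<Rightarrow> bool"
  where "same_multiset_on S f g \<longleftrightarrow> (\<forall>r. {i \<in> S. f i = r} \<approx> {i \<in> S. g i = r})"

end

theory Submission
  imports Defs
begin

text \<open>
  The unbounded operators are replaced by their resolvents \<open>R t = 1 / (A t - \<i>)\<close>, compact operators of
  norm at most 1 with the same eigenvectors. Either regularity assumption implies that \<open>t \<mapsto> R t\<close>
  is differentiable in the operator norm: for a \<open>C1_Holder\<close> curve this follows from two
  applications of the
  uniform boundedness principle (\<open>C1_Holder_curve_resolvent_differentiable\<close>), for a \<open>C1\<close> resolvent by
  restriction to \<open>z = \<i>\<close> (\<open>C1_resolvent_differentiable\<close>).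

  Fix \<open>t\<close> and an eigenvalue \<open>z\<close> of \<open>A t\<close> with eigenspace \<open>E\<close>. Along any sequence of parameters that
  tends to \<open>t\<close>, compactness extracts from orthonormal eigenvectors for the eigenvalues near \<open>z\<close> an
  orthonormal basis of \<open>E\<close>. In this basis the compression to \<open>E\<close> of the derivative of \<open>R\<close> at \<open>t\<close> is
  diagonal, and its diagonal entries are, up to the factor \<open>- 1 / (z - \<i>)\<^sup>2\<close>, the limits of the difference
  quotients of the \<open>l i\<close> with \<open>l i t = z\<close> (\<open>eigenvalue_quotients_subsequence\<close>). Hence these quotients
  have as cluster values only the eigenvalues of one matrix; being continuous functions on either
  side of \<open>t\<close>, they converge there (\<open>tendsto_if_finitely_many_cluster_values\<close>). The limits from the
  right and from the left are both the diagonal entries of the same compression in some basis, so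
  they agree with multiplicity (\<open>diagonalizes_card_le\<close>).
\<close>

section \<open>Complex inner products\<close>

instance complex_hilbert_space \<subseteq> banach
  by standard

lemma cinner_add_right: "cinner x (y + z) = cinner x y + cinner x (z::'a::complex_hilbert_space)"
  by (metis cinner_add_left cinner_commute complex_cnj_add)

lemma cinner_scaleC_right: "cinner x (c *\<^sub>C y) = cnj c * cinner x (y::'a::complex_hilbert_space)"
  by (metis cinner_commute cinner_scaleC_left complex_cnj_mult)

lemma cinner_scaleR_left: "cinner (r *\<^sub>R x) y = r *\<^sub>R cinner x (y::'a::complex_hilbert_space)"
  by (simp add: cinner_scaleC_left scaleR_conv_of_real flip: scaleC_of_real)

lemma cinner_scaleR_right: "cinner x (r *\<^sub>R y) = r *\<^sub>R cinner x (y::'a::complex_hilbert_space)"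
  by (simp add: cinner_scaleC_right scaleR_conv_of_real flip: scaleC_of_real)

lemma cinner_self: "cinner x x = complex_of_real ((norm (x::'a::complex_hilbert_space))\<^sup>2)"
proof (rule complex_eqI)
  show "Im (cinner x x) = Im (complex_of_real ((norm x)\<^sup>2))"
    using cinner_commute[of x x] by (simp add: complex_eq_iff)
qed (simp add: Re_cinner power2_norm_eq_inner)

lemma norm_scaleC: "norm (c *\<^sub>C x) = cmod c * norm (x::'a::complex_hilbert_space)"
proof -
  have "complex_of_real ((norm (c *\<^sub>C x))\<^sup>2) = c * cnj c * cinner x x"
    by (simp only: cinner_self[symmetric] cinner_scaleC_left cinner_scaleC_right mult_ac)
  also have "\<dots> = complex_of_real ((cmod c * norm x)\<^sup>2)"
    by (simp only: complex_norm_square[symmetric] cinner_self power_mult_distrib of_real_mult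
        of_real_power)
  finally have "complex_of_real ((norm (c *\<^sub>C x))\<^sup>2) = complex_of_real ((cmod c * norm x)\<^sup>2)" .
  then have "(norm (c *\<^sub>C x))\<^sup>2 = (cmod c * norm x)\<^sup>2"
    by (simp only: of_real_eq_iff)
  then show ?thesis
    by (simp add: power2_eq_iff_nonneg)
qed

lemma cmod_cinner_le: "cmod (cinner x y) \<le> norm x * norm (y::'a::complex_hilbert_space)"
proof (cases "cinner x y = 0")
  case False
  \<comment> \<open>rotating \<open>x\<close> makes the inner product real and nonnegative\<close>
  define u where "u = cnj (sgn (cinner x y))"
  have "cinner (u *\<^sub>C x) y = complex_of_real (cmod (cinner x y))"
    using False complex_norm_square[of "cinner x y"]
    by (simp add: u_def cinner_scaleC_left sgn_eq field_simps power2_eq_square)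
  then have "cmod (cinner x y) = inner (u *\<^sub>C x) y"
    by (metis Re_cinner Re_complex_of_real)
  also have "\<dots> \<le> norm (u *\<^sub>C x) * norm y"
    by (rule norm_cauchy_schwarz)
  also have "\<dots> = norm x * norm y"
    using False by (simp add: norm_scaleC u_def norm_sgn)
  finally show ?thesis .
qed simp

interpretation cinner: bounded_bilinear "cinner :: 'a::complex_hilbert_space \<Rightarrow> 'a \<Rightarrow> complex"
  by standard
    (auto simp: cinner_add_left cinner_add_right cinner_scaleR_left cinner_scaleR_right
      intro!: exI[of _ 1] cmod_cinner_le)

interpretation scaleC: bounded_bilinear "scaleC :: complex \<Rightarrow> 'a::complex_hilbert_space \<Rightarrow> 'a"
proof
  show "\<exists>K. \<forall>c x. norm (c *\<^sub>C x :: 'a) \<le> cmod c * norm x * K"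
    by (intro exI[of _ 1]) (simp add: norm_scaleC)
qed (simp_all add: scaleC_add_left scaleC_add_right scaleC_scaleC scaleR_conv_of_real
    mult.commute flip: scaleC_of_real)

text \<open>By continuity the bound holds for all \<open>v\<close>, in particular for \<open>v = y\<close>.\<close>

lemma norm_le_if_cinner_le_on_dense:
  fixes y :: "'a::complex_hilbert_space"
  assumes dense: "closure V = UNIV" and "0 \<le> C"
    and le: "\<And>v. v \<in> V \<Longrightarrow> cmod (cinner y v) \<le> C * norm v"
  shows "norm y \<le> C"
proof (cases "y = 0")
  case True
  then show ?thesis using \<open>0 \<le> C\<close> by simp
next
  case False
  have "closed {v. cmod (cinner y v) \<le> C * norm v}"
    by (intro closed_Collect_le continuous_on_norm cinner.continuous_on continuous_intros) 
  then have "closure V \<subseteq> {v. cmod (cinner y v) \<le> C * norm v}"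
    using le by (intro closure_minimal) auto
  then have "cmod (cinner y y) \<le> C * norm y"
    using dense by auto
  then show ?thesis
    using False by (simp add: cinner_self power2_eq_square norm_mult)
qed

section \<open>Orthonormal families\<close>

definition orthonormal_on :: "'i set \<Rightarrow> ('i \<Rightarrow> 'a::complex_hilbert_space) \<Rightarrow> bool"
  where "orthonormal_on S e \<longleftrightarrow> (\<forall>i\<in>S. \<forall>j\<in>S. cinner (e i) (e j) = (if i = j then 1 else 0))"

lemma orthonormal_onD:
  "orthonormal_on S e \<Longrightarrow> i \<in> S \<Longrightarrow> j \<in> S \<Longrightarrow> cinner (e i) (e j) = (if i = j then 1 else 0)"
  by (simp add: orthonormal_on_def)

lemma orthonormal_on_norm:
  assumes "orthonormal_on S e" "i \<in> S"
  shows "norm (e i) = 1"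
proof -
  have "complex_of_real ((norm (e i))\<^sup>2) = 1"
    using orthonormal_onD[OF assms(1,2,2)] by (simp add: cinner_self)
  then have "(norm (e i))\<^sup>2 = 1"
    by (metis of_real_1 of_real_eq_iff)
  then show ?thesis
    by (simp add: power2_eq_1_iff) (smt (verit) norm_ge_zero)
qed

lemma orthonormal_on_inj: "orthonormal_on S e \<Longrightarrow> inj_on e S"
  by (metis inj_onI orthonormal_onD zero_neq_one)

lemma orthonormal_on_subset: "orthonormal_on S e \<Longrightarrow> T \<subseteq> S \<Longrightarrow> orthonormal_on T e"
  unfolding orthonormal_on_def by blast

lemma orthonormal_on_expansion:
  fixes e :: "'i \<Rightarrow> 'a::complex_hilbert_space"
  assumes "orthonormal_on S e" "finite S" "x \<in> cvec.span (e ` S)"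
  shows "x = (\<Sum>i\<in>S. cinner x (e i) *\<^sub>C e i)"
  using assms(3)
proof (induction rule: cvec.span_induct_alt)
  case (step c y x)
  then obtain k where k: "k \<in> S" "y = e k" by blast
  have "(\<Sum>i\<in>S. cinner (c *\<^sub>C y + x) (e i) *\<^sub>C e i)
      = (\<Sum>i\<in>S. (if i = k then c else 0) *\<^sub>C e i) + (\<Sum>i\<in>S. cinner x (e i) *\<^sub>C e i)"
    unfolding sum.distrib[symmetric]
    by (rule sum.cong)
      (auto simp: k cinner_add_left cinner_scaleC_left scaleC_add_left orthonormal_onD[OF assms(1)])
  also have "(\<Sum>i\<in>S. (if i = k then c else 0) *\<^sub>C e i) = c *\<^sub>C e k"
    using assms(2) k by (subst sum.remove[of _ k]) auto
  finally show ?case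
    using step k by simp
qed (simp add: cinner.zero_left)

lemma orthonormal_on_independent:
  fixes e :: "'i \<Rightarrow> 'a::complex_hilbert_space"
  assumes "orthonormal_on S e"
  shows "cvec.independent (e ` S)"
proof (rule ccontr)
  assume "\<not> cvec.independent (e ` S)"
  then obtain T u v where T: "finite T" "T \<subseteq> e ` S" "(\<Sum>x\<in>T. u x *\<^sub>C x) = 0" "v \<in> T" "u v \<noteq> 0"
    unfolding cvec.dependent_explicit by blast
  have "0 = (\<Sum>x\<in>T. u x * cinner x v)"
    using T(3) by (metis (no_types, lifting) cinner.sum_left cinner.zero_left cinner_scaleC_left sum.cong)
  also have "\<dots> = (\<Sum>x\<in>T. if x = v then u v else 0)"
  proof (rule sum.cong)
    fix x assume "x \<in> T"
    then obtain i j where "i \<in> S" "x = e i" "j \<in> S" "v = e j"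
      using T(2,4) by blast
    then show "u x * cinner x v = (if x = v then u v else 0)"
      using orthonormal_onD[OF assms, of i j] orthonormal_on_norm[OF assms, of i]
      by (auto simp: cinner_self)
  qed simp
  finally show False
    using T by simp
qed

text \<open>
  Gram--Schmidt orthonormalisation. It turns a multiplicity, which is the cardinality of some
  algebraic basis, into a number of orthonormal eigenvectors.
\<close>

lemma independent_imp_orthonormal_basis:
  fixes B :: "'a::complex_hilbert_space set"
  assumes "finite B" "cvec.independent B"
  shows "\<exists>e. orthonormal_on B e \<and> cvec.span (e ` B) = cvec.span B"
  using assms
proof (induction B rule: finite_induct)
  case empty
  then show ?case by (simp add: orthonormal_on_def)
next
  case (insert b B)
  then have indep: "cvec.independent B" "b \<notin> cvec.span B"
    by (auto simp: cvec.independent_insert)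
  with insert obtain e where e: "orthonormal_on B e" "cvec.span (e ` B) = cvec.span B" by blast
  define p where "p = (\<Sum>i\<in>B. cinner b (e i) *\<^sub>C e i)"
  define w where "w = b - p"
  have p: "p \<in> cvec.span B"
    unfolding p_def e(2)[symmetric] by (intro cvec.span_sum cvec.span_scale cvec.span_base) auto
  have "w \<noteq> 0"
    using p indep by (auto simp: w_def)
  have pe: "cinner p (e j) = cinner b (e j)" if "j \<in> B" for j
  proof -
    have "cinner p (e j) = (\<Sum>i\<in>B. if i = j then cinner b (e j) else 0)"
      unfolding p_def cinner.sum_left
      by (rule sum.cong) (auto simp: cinner_scaleC_left orthonormal_onD[OF e(1)] that)
    then show ?thesis using insert(1) that by simp
  qed
  have we: "cinner w (e j) = 0" if "j \<in> B" for j
    using pe[OF that] by (simp add: w_def cinner.diff_left)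
  have ew: "cinner (e j) w = 0" if "j \<in> B" for j
    using we[OF that] cinner_commute[of "e j" w] by simp
  define f where "f = e(b := complex_of_real (1 / norm w) *\<^sub>C w)"
  have "f ` B = e ` B"
    using insert(2) by (auto simp: f_def)
  have "orthonormal_on (insert b B) f"
    using insert(2) \<open>w \<noteq> 0\<close>
    by (auto simp: orthonormal_on_def f_def cinner_scaleC_left cinner_scaleC_right we ew
        cinner_self orthonormal_onD[OF e(1)] orthonormal_on_norm[OF e(1)] power2_eq_square)
  moreover have "cvec.span (f ` insert b B) = cvec.span (insert b B)"
  proof -
    have fb: "f b = complex_of_real (1 / norm w) *\<^sub>C w" by (simp add: f_def)
    have "cvec.span (f ` insert b B) = cvec.span (insert (f b) B)"
      by (simp add: \<open>f ` B = e ` B\<close> cvec.span_insert e(2))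
    also have "\<dots> = cvec.span (insert b B)"
    proof (rule cvec.span_eq[THEN iffD2], intro conjI subsetI)
      fix x assume "x \<in> insert (f b) B"
      moreover have "f b \<in> cvec.span (insert b B)"
        unfolding fb w_def using p
        by (intro cvec.span_scale cvec.span_diff)
          (auto intro: cvec.span_base cvec.span_mono[THEN subsetD, rotated])
      ultimately show "x \<in> cvec.span (insert b B)"
        by (auto intro: cvec.span_base)
    next
      fix x assume "x \<in> insert b B"
      moreover have "b = complex_of_real (norm w) *\<^sub>C f b + p"
        using \<open>w \<noteq> 0\<close> by (simp add: fb scaleC_scaleC w_def)
      moreover have "complex_of_real (norm w) *\<^sub>C f b + p \<in> cvec.span (insert (f b) B)"
        using p by (intro cvec.span_add cvec.span_scale)
          (auto intro: cvec.span_base cvec.span_mono[THEN subsetD, rotated])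
      ultimately show "x \<in> cvec.span (insert (f b) B)"
        by (metis cvec.span_base insertE insertCI)
    qed
    finally show ?thesis .
  qed
  ultimately show ?case by blast
qed

text \<open>A vector outside the span would give more independent vectors than \<open>B\<close> has elements.\<close>

lemma orthonormal_on_spans:
  fixes e :: "'i \<Rightarrow> 'a::complex_hilbert_space"
  assumes e: "orthonormal_on S e" "finite S" "e ` S \<subseteq> cvec.span B"
    and B: "finite B" "card B \<le> card S"
  shows "cvec.span (e ` S) = cvec.span B"
proof (rule antisym)
  show "cvec.span (e ` S) \<subseteq> cvec.span B"
    using e(3) by (simp add: cvec.span_minimal)
  show "cvec.span B \<subseteq> cvec.span (e ` S)"
  proof
    fix x assume x: "x \<in> cvec.span B"
    show "x \<in> cvec.span (e ` S)"
    proof (rule ccontr)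
      assume "x \<notin> cvec.span (e ` S)"
      then have "x \<notin> e ` S"
        by (blast intro: cvec.span_base)
      have "cvec.independent (insert x (e ` S))"
        using \<open>x \<notin> cvec.span (e ` S)\<close> orthonormal_on_independent[OF e(1)]
        by (rule cvec.independent_insertI)
      moreover have "insert x (e ` S) \<subseteq> cvec.span B"
        using x e(3) by auto
      ultimately have "card (insert x (e ` S)) \<le> card B"
        using cvec.independent_span_bound[OF B(1)] by blast
      moreover have "card (insert x (e ` S)) = Suc (card S)"
        using \<open>x \<notin> e ` S\<close> e(2) card_image[OF orthonormal_on_inj[OF e(1)]] by simp
      ultimately show False
        using B(2) by simp
    qed
  qed
qed

section \<open>Self-adjoint operators and their resolvents\<close>

text \<open>
  The vector from a point outside \<open>M\<close> to its best approximation in \<open>M\<close> is orthogonal to \<open>M\<close>.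
\<close>

lemma orthogonal_complement_nontrivial:
  fixes M :: "'a::complex_hilbert_space set"
  assumes "cvec.subspace M" "closed M" "x \<notin> M"
  shows "\<exists>y. y \<noteq> 0 \<and> (\<forall>m\<in>M. cinner m y = 0)"
proof -
  define D where "D = Inf ((\<lambda>m. (norm (x - m))\<^sup>2) ` M)"
  have "M \<noteq> {}"
    using cvec.subspace_0[OF assms(1)] by auto
  have bdd: "bdd_below ((\<lambda>m. (norm (x - m))\<^sup>2) ` M)"
    by (rule bdd_belowI[of _ 0]) auto
  have D_le: "D \<le> (norm (x - m))\<^sup>2" if "m \<in> M" for m
    unfolding D_def using bdd that by (intro cInf_lower) auto
  have "\<exists>m\<in>M. (norm (x - m))\<^sup>2 < D + 1 / real (Suc n)" for n
    using cInf_lessD[of "(\<lambda>m. (norm (x - m))\<^sup>2) ` M" "D + 1 / real (Suc n)"] \<open>M \<noteq> {}\<close>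
    by (auto simp: D_def[symmetric])
  then obtain m where m: "\<And>n. m n \<in> M" "\<And>n. (norm (x - m n))\<^sup>2 < D + 1 / real (Suc n)"
    by metis
  have real_sub: "a *\<^sub>R u + b *\<^sub>R v \<in> M" if "u \<in> M" "v \<in> M" for a b u v
    using that assms(1)
    by (metis cvec.subspace_add cvec.subspace_scale scaleC_of_real)
  \<comment> \<open>by the parallelogram law, as the midpoint of two points of \<open>M\<close> is not closer to \<open>x\<close>\<close>
  have dist_le: "(norm (m n - m k))\<^sup>2 \<le> 2 / real (Suc n) + 2 / real (Suc k)" for n k
  proof -
    have "(norm (m n - m k))\<^sup>2 = 2 * (norm (x - m n))\<^sup>2 + 2 * (norm (x - m k))\<^sup>2
        - 4 * (norm (x - ((1/2) *\<^sub>R m n + (1/2) *\<^sub>R m k)))\<^sup>2"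
      unfolding power2_norm_eq_inner
      by (simp add: inner_diff_left inner_diff_right inner_add_left inner_add_right inner_commute
          algebra_simps)
    then show ?thesis
      using m(2)[of n] m(2)[of k] D_le[OF real_sub[OF m(1)[of n] m(1)[of k], of "1/2" "1/2"]]
      by simp
  qed
  have "Cauchy m"
  proof (rule metric_CauchyI)
    fix e :: real assume "e > 0"
    then obtain N where N: "4 / e\<^sup>2 < real N"
      using reals_Archimedean2 by blast
    have "dist (m n) (m k) < e" if "n \<ge> N" "k \<ge> N" for n k
    proof -
      have N0: "0 < real N"
        using N \<open>e > 0\<close> by (smt (verit) divide_pos_pos zero_less_power)
      have "(norm (m n - m k))\<^sup>2 \<le> 2 / real (Suc n) + 2 / real (Suc k)"
        by (rule dist_le)
      also have "\<dots> \<le> 2 / real N + 2 / real N"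
        using that N0 by (intro add_mono divide_left_mono) auto
      also have "\<dots> < e\<^sup>2"
        using N N0 \<open>e > 0\<close> by (simp add: field_simps)
      finally show ?thesis
        using \<open>e > 0\<close> by (simp add: dist_norm power_less_imp_less_base)
    qed
    then show "\<exists>N. \<forall>n\<ge>N. \<forall>k\<ge>N. dist (m n) (m k) < e" by blast
  qed
  then obtain p where p: "m \<longlonglongrightarrow> p"
    using Cauchy_convergent convergent_def by blast
  have "p \<in> M"
    using p m(1) assms(2) closed_sequentially by blast
  have "(norm (x - p))\<^sup>2 \<le> D"
  proof (rule LIMSEQ_le)
    show "(\<lambda>n. (norm (x - m n))\<^sup>2) \<longlonglongrightarrow> (norm (x - p))\<^sup>2"
      using p by (intro tendsto_intros)
    show "(\<lambda>n. D + 1 / real (Suc n)) \<longlonglongrightarrow> D"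
      using tendsto_add[OF tendsto_const LIMSEQ_inverse_real_of_nat, of D]
      by (simp add: inverse_eq_divide)
    show "\<exists>N. \<forall>n\<ge>N. (norm (x - m n))\<^sup>2 \<le> D + 1 / real (Suc n)"
      using m(2) less_imp_le by blast
  qed
  have orth: "inner v (x - p) = 0" if "v \<in> M" for v
  proof (cases "v = 0")
    case False
    define s where "s = inner v (x - p) / inner v v"
    have "(norm (x - p))\<^sup>2 \<le> (norm (x - (1 *\<^sub>R p + s *\<^sub>R v)))\<^sup>2"
      using \<open>(norm (x - p))\<^sup>2 \<le> D\<close> D_le[OF real_sub[OF \<open>p \<in> M\<close> that, of 1 s]] by linarith
    also have "\<dots> = (norm (x - p))\<^sup>2 - 2 * s * inner v (x - p) + s * (s * inner v v)"
      unfolding power2_norm_eq_inner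
      by (simp add: inner_diff_left inner_diff_right inner_add_left inner_add_right inner_commute
          algebra_simps)
    also have "s * inner v v = inner v (x - p)"
      using False by (simp add: s_def)
    finally have "s * inner v (x - p) \<le> 0"
      by simp
    then have "(inner v (x - p))\<^sup>2 / inner v v \<le> 0"
      by (simp add: s_def power2_eq_square)
    moreover have "inner v v > 0"
      using False by (simp only: inner_gt_zero_iff not_False_eq_True)
    ultimately show ?thesis
      by (simp only: divide_le_0_iff zero_le_power2 power2_less_eq_zero_iff) simp
  qed simp
  have "cinner v (x - p) = 0" if "v \<in> M" for v
  proof (rule complex_eqI)
    show "Re (cinner v (x - p)) = Re 0"
      using orth[OF that] by (simp add: Re_cinner)
    have "\<i> *\<^sub>C v \<in> M"
      using that assms(1) by (simp add: cvec.subspace_scale)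
    then have "Re (cinner (\<i> *\<^sub>C v) (x - p)) = 0"
      using orth by (simp add: Re_cinner)
    then show "Im (cinner v (x - p)) = Im 0"
      by (simp add: cinner_scaleC_left)
  qed
  moreover have "x - p \<noteq> 0"
    using \<open>p \<in> M\<close> assms(3) by auto
  ultimately show ?thesis by blast
qed

locale self_adjoint =
  fixes V :: "'a::complex_hilbert_space set" and T :: "'a \<Rightarrow> 'a"
  assumes self_adjoint: "self_adjoint_operator V T"
begin

lemma subspace: "cvec.subspace V"
  and dense: "closure V = UNIV"
  and add: "x \<in> V \<Longrightarrow> y \<in> V \<Longrightarrow> T (x + y) = T x + T y"
  and scaleC: "x \<in> V \<Longrightarrow> T (c *\<^sub>C x) = c *\<^sub>C T x"
  and adjoint_iff: "(\<forall>x\<in>V. cinner (T x) y = cinner x w) \<longleftrightarrow> y \<in> V \<and> w = T y"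
  using self_adjoint
  by (auto simp: self_adjoint_operator_def densely_defined_operator_def adjoint_graph_def set_eq_iff)

lemma symmetric: "x \<in> V \<Longrightarrow> y \<in> V \<Longrightarrow> cinner (T x) y = cinner x (T y)"
  using adjoint_iff[of y "T y"] by blast

lemma diff: "x \<in> V \<Longrightarrow> y \<in> V \<Longrightarrow> T (x - y) = T x - T y"
  using add[of x "(-1) *\<^sub>C y"] scaleC[of y "-1"] cvec.subspace_scale[OF subspace, of y "-1"]
  by (simp add: cvec.scale_minus_left)

lemma closed_graph:
  assumes "\<And>n. x n \<in> V" "x \<longlonglongrightarrow> u" "(\<lambda>n. T (x n)) \<longlonglongrightarrow> w"
  shows "u \<in> V \<and> w = T u"
  unfolding adjoint_iff[symmetric]
proof
  fix v assume "v \<in> V"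
  have "(\<lambda>n. cinner (T v) (x n)) \<longlonglongrightarrow> cinner (T v) u"
    using assms(2) by (intro cinner.tendsto tendsto_const)
  moreover have "(\<lambda>n. cinner (T v) (x n)) \<longlonglongrightarrow> cinner v w"
    using cinner.tendsto[OF tendsto_const assms(3), of v] assms(1) \<open>v \<in> V\<close> by (simp add: symmetric)
  ultimately show "cinner (T v) u = cinner v w"
    by (rule LIMSEQ_unique)
qed

text \<open>By symmetry \<open>\<parallel>T x - \<i> x\<parallel>\<^sup>2 = \<parallel>T x\<parallel>\<^sup>2 + \<parallel>x\<parallel>\<^sup>2\<close>.\<close>

lemma norm_le_norm_shift:
  assumes "x \<in> V"
  shows "norm x \<le> norm (T x - \<i> *\<^sub>C x)"
proof -
  have "cinner (T x - \<i> *\<^sub>C x) (T x - \<i> *\<^sub>C x) = cinner (T x) (T x) + cinner x x"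
    using symmetric[OF assms assms]
    by (simp add: cinner.diff_left cinner.diff_right cinner_scaleC_left cinner_scaleC_right
        algebra_simps)
  then have "complex_of_real ((norm (T x - \<i> *\<^sub>C x))\<^sup>2) = complex_of_real ((norm (T x))\<^sup>2 + (norm x)\<^sup>2)"
    by (simp only: cinner_self of_real_add)
  then have "(norm (T x - \<i> *\<^sub>C x))\<^sup>2 = (norm (T x))\<^sup>2 + (norm x)\<^sup>2"
    by (simp only: of_real_eq_iff)
  then show ?thesis
    by (simp add: power2_le_imp_le)
qed

text \<open>
  The range is closed because \<open>T\<close> is closed and \<open>T - \<i>\<close> is bounded below. A vector \<open>y\<close> orthogonal to
  it lies in the domain of the adjoint of \<open>T\<close>, with \<open>T y = - \<i> y\<close>; as \<open>T\<close> is symmetric, \<open>y = 0\<close>.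
\<close>

lemma range_shift: "(\<lambda>x. T x - \<i> *\<^sub>C x) ` V = UNIV" (is "?M = UNIV")
proof (rule ccontr)
  have lin: "c *\<^sub>C (T x - \<i> *\<^sub>C x) = T (c *\<^sub>C x) - \<i> *\<^sub>C (c *\<^sub>C x)"
    "(T x - \<i> *\<^sub>C x) + (T y - \<i> *\<^sub>C y) = T (x + y) - \<i> *\<^sub>C (x + y)"
    "(T x - \<i> *\<^sub>C x) - (T y - \<i> *\<^sub>C y) = T (x - y) - \<i> *\<^sub>C (x - y)"
    if "x \<in> V" "y \<in> V" for x y c
    using that
    by (auto simp: add diff scaleC cvec.scale_right_diff_distrib scaleC_scaleC mult.commute
        scaleC_add_right)
  have sub: "cvec.subspace ?M"
  proof (rule cvec.subspaceI)
    show "0 \<in> ?M"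
      using cvec.subspace_0[OF subspace] scaleC[of 0 0] by (auto intro!: image_eqI[of _ _ 0])
  next
    fix a b assume "a \<in> ?M" "b \<in> ?M"
    then show "a + b \<in> ?M"
      using lin(2) by (auto intro!: imageI cvec.subspace_add[OF subspace])
  next
    fix c a assume "a \<in> ?M"
    then obtain x where "x \<in> V" "a = T x - \<i> *\<^sub>C x" by blast
    then have "c *\<^sub>C a = T (c *\<^sub>C x) - \<i> *\<^sub>C (c *\<^sub>C x)"
      using lin(1)[of x x c] by simp
    then show "c *\<^sub>C a \<in> ?M"
      using cvec.subspace_scale[OF subspace \<open>x \<in> V\<close>] by (rule image_eqI)
  qed
  have "closed ?M"
    unfolding closed_sequential_limits
  proof (intro allI impI, elim conjE)
    fix s y assume s: "\<forall>n. s n \<in> ?M" "s \<longlonglongrightarrow> y"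
    then have "\<forall>n. \<exists>x. x \<in> V \<and> s n = T x - \<i> *\<^sub>C x"
      by blast
    then obtain x where x: "\<And>n. x n \<in> V" "\<And>n. s n = T (x n) - \<i> *\<^sub>C x n"
      using choice[of "\<lambda>n x. x \<in> V \<and> s n = T x - \<i> *\<^sub>C x"] by blast
    have "dist (x n) (x k) \<le> dist (s n) (s k)" for n k
      using norm_le_norm_shift[of "x n - x k"] x lin(3) cvec.subspace_diff[OF subspace]
      by (simp add: dist_norm)
    moreover have "Cauchy s"
      using s(2) convergent_Cauchy convergentI by blast
    ultimately have "Cauchy x"
      unfolding Cauchy_def by (meson le_less_trans)
    then obtain u where u: "x \<longlonglongrightarrow> u"
      using Cauchy_convergent convergent_def by blast
    have "(\<lambda>n. s n + \<i> *\<^sub>C x n) \<longlonglongrightarrow> y + \<i> *\<^sub>C u"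
      using s(2) u by (intro tendsto_intros scaleC.tendsto)
    then have "(\<lambda>n. T (x n)) \<longlonglongrightarrow> y + \<i> *\<^sub>C u"
      by (simp add: x(2))
    from closed_graph[OF x(1) u this] have "u \<in> V" "y = T u - \<i> *\<^sub>C u"
      by (auto simp: algebra_simps)
    then show "y \<in> ?M" by blast
  qed
  assume "?M \<noteq> UNIV"
  then have "\<exists>a. a \<notin> ?M"
    using UNIV_eq_I[of ?M] by metis
  then obtain a where "a \<notin> ?M" ..
  then obtain y where y: "y \<noteq> 0" "\<And>m. m \<in> ?M \<Longrightarrow> cinner m y = 0"
    using orthogonal_complement_nontrivial[OF sub \<open>closed ?M\<close>, of a] by metis
  have "cinner (T x) y = cinner x (- \<i> *\<^sub>C y)" if "x \<in> V" for x
    using y(2)[of "T x - \<i> *\<^sub>C x"] that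
    by (auto simp: cinner.diff_left cinner_scaleC_left cinner_scaleC_right cinner.minus_right)
  then have Ty: "y \<in> V" "T y = - \<i> *\<^sub>C y"
    using adjoint_iff[of y "- \<i> *\<^sub>C y"] by auto
  then have "cinner y y = 0"
    using symmetric[OF Ty(1) Ty(1)] by (auto simp: cinner_scaleC_left cinner_scaleC_right
        cinner.minus_left cinner.minus_right)
  then show False
    using y(1) by (simp add: cinner_self)
qed

lemma resolvent_inverse:
  assumes "z \<in> resolvent_set V T"
  shows "blinfun_apply (resolvent V T z) f \<in> V"
    and "T (blinfun_apply (resolvent V T z) f) - z *\<^sub>C blinfun_apply (resolvent V T z) f = f"
    and "x \<in> V \<Longrightarrow> blinfun_apply (resolvent V T z) (T x - z *\<^sub>C x) = x"
proof -
  have app: "blinfun_apply (resolvent V T z) = inv_into V (\<lambda>x. T x - z *\<^sub>C x)"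
    and bij: "bij_betw (\<lambda>x. T x - z *\<^sub>C x) V UNIV"
    using assms by (auto simp: resolvent_set_def resolvent_def bounded_linear_Blinfun_apply)
  show "blinfun_apply (resolvent V T z) f \<in> V"
    using bij by (auto simp: app bij_betw_def intro: inv_into_into)
  show "T (blinfun_apply (resolvent V T z) f) - z *\<^sub>C blinfun_apply (resolvent V T z) f = f"
    using bij bij_betw_inv_into_right[OF bij, of f] by (simp add: app)
  show "x \<in> V \<Longrightarrow> blinfun_apply (resolvent V T z) (T x - z *\<^sub>C x) = x"
    using bij_betw_inv_into_left[OF bij, of x] by (simp add: app)
qed

lemma imaginary_unit_in_resolvent_set: "\<i> \<in> resolvent_set V T"
proof -
  let ?g = "\<lambda>x. T x - \<i> *\<^sub>C x"
  have inj: "inj_on ?g V"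
  proof (rule inj_onI)
    fix x y assume xy: "x \<in> V" "y \<in> V" "?g x = ?g y"
    have "T (x - y) - \<i> *\<^sub>C (x - y) = ?g x - ?g y"
      using xy(1,2) by (simp add: diff cvec.scale_right_diff_distrib)
    then show "x = y"
      using norm_le_norm_shift[OF cvec.subspace_diff[OF subspace xy(1,2)]] xy(3) by simp
  qed
  have bij: "bij_betw ?g V UNIV"
    using inj range_shift by (simp add: bij_betw_def)
  have inv: "inv_into V ?g f \<in> V" "?g (inv_into V ?g f) = f" for f
    using range_shift by (auto intro: inv_into_into f_inv_into_f)
  have "bounded_linear (inv_into V ?g)"
  proof (rule bounded_linear_intro[where K = 1])
    fix f h
    have "?g (inv_into V ?g f + inv_into V ?g h) = f + h"
      using inv[of f] inv[of h] by (simp add: add scaleC_add_right algebra_simps)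
    then show "inv_into V ?g (f + h) = inv_into V ?g f + inv_into V ?g h"
      using bij_betw_inv_into_left[OF bij, of "inv_into V ?g f + inv_into V ?g h"]
        cvec.subspace_add[OF subspace inv(1)[of f] inv(1)[of h]] by simp
  next
    fix r f
    have "?g (r *\<^sub>R inv_into V ?g f) = r *\<^sub>R f"
      using scaleC[OF inv(1)[of f], of "complex_of_real r"] inv(2)[of f]
        scaleC.scaleR_right[of \<i> r "inv_into V ?g f"]
      by (simp add: scaleC_of_real flip: scaleR_diff_right)
    moreover have "r *\<^sub>R inv_into V ?g f \<in> V"
      using cvec.subspace_scale[OF subspace inv(1)[of f], of "complex_of_real r"]
      by (simp add: scaleC_of_real)
    ultimately show "inv_into V ?g (r *\<^sub>R f) = r *\<^sub>R inv_into V ?g f"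
      using bij_betw_inv_into_left[OF bij, of "r *\<^sub>R inv_into V ?g f"] by simp
  next
    fix f
    show "norm (inv_into V ?g f) \<le> norm f * 1"
      using norm_le_norm_shift[OF inv(1)[of f]] inv(2)[of f] by simp
  qed
  with bij show ?thesis
    by (simp add: resolvent_set_def)
qed

text \<open>
  The shift \<open>\<i>\<close> suits all self-adjoint operators at once, so that a curve of operators gives a curve
  of resolvents that is defined for all parameters and bounded by 1.
\<close>

abbreviation R :: "'a \<Rightarrow>\<^sub>L 'a"
  where "R \<equiv> resolvent V T \<i>"

lemmas R_inverse = resolvent_inverse[OF imaginary_unit_in_resolvent_set]

lemma norm_R_apply_le: "norm (R f) \<le> norm f"
  using norm_le_norm_shift[OF R_inverse(1)[of f]] R_inverse(2)[of f] by simp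

lemma R_scaleC: "R (c *\<^sub>C f) = c *\<^sub>C R f"
proof -
  have "T (c *\<^sub>C R f) - \<i> *\<^sub>C (c *\<^sub>C R f) = c *\<^sub>C (T (R f) - \<i> *\<^sub>C R f)"
    using cvec.scale_left_commute[of c \<i> "R f"]
    by (simp only: scaleC[OF R_inverse(1)[of f]] cvec.scale_right_diff_distrib)
  then have "T (c *\<^sub>C R f) - \<i> *\<^sub>C (c *\<^sub>C R f) = c *\<^sub>C f"
    by (simp only: R_inverse(2))
  then show ?thesis
    using R_inverse(3)[OF cvec.subspace_scale[OF subspace R_inverse(1)[of f]], of c] by simp
qed

text \<open>
  Eigenvectors of the unbounded operator are those of its bounded resolvent, the eigenvalues being
  related by \<open>z \<mapsto> 1 / (z - \<i>)\<close>.
\<close>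

lemma eigenspace_iff_R:
  "x \<in> eigenspace V T (complex_of_real z) \<longleftrightarrow> R x = (1 / (complex_of_real z - \<i>)) *\<^sub>C x"
proof -
  have nz: "complex_of_real z - \<i> \<noteq> 0"
    by (auto simp: complex_eq_iff)
  show ?thesis
  proof
    assume "x \<in> eigenspace V T (complex_of_real z)"
    then have x: "x \<in> V" "T x - \<i> *\<^sub>C x = (complex_of_real z - \<i>) *\<^sub>C x"
      by (auto simp: eigenspace_def cvec.scale_left_diff_distrib)
    have "(1 / (complex_of_real z - \<i>)) *\<^sub>C x
        = (1 / (complex_of_real z - \<i>)) *\<^sub>C R (T x - \<i> *\<^sub>C x)"
      using R_inverse(3)[OF x(1)] by simp
    also have "\<dots> = R x"
      using nz by (simp add: x(2) R_scaleC scaleC_scaleC)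
    finally show "R x = (1 / (complex_of_real z - \<i>)) *\<^sub>C x" ..
  next
    assume Rx: "R x = (1 / (complex_of_real z - \<i>)) *\<^sub>C x"
    then have "x = (complex_of_real z - \<i>) *\<^sub>C R x"
      using nz by (simp add: scaleC_scaleC)
    then have "x \<in> V"
      using R_inverse(1) subspace by (metis cvec.subspace_scale)
    have "(complex_of_real z - \<i>) *\<^sub>C R x = x"
      using Rx nz by (simp add: scaleC_scaleC)
    then have "T x - \<i> *\<^sub>C x = (complex_of_real z - \<i>) *\<^sub>C (T (R x) - \<i> *\<^sub>C R x)"
      using scaleC[OF R_inverse(1)[of x], of "complex_of_real z - \<i>"]
        cvec.scale_left_commute[of "complex_of_real z - \<i>" \<i> "R x"]
      by (simp only: cvec.scale_right_diff_distrib)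
    then have "T x - \<i> *\<^sub>C x = (complex_of_real z - \<i>) *\<^sub>C x"
      by (simp only: R_inverse(2))
    then show "x \<in> eigenspace V T (complex_of_real z)"
      using \<open>x \<in> V\<close> by (simp add: eigenspace_def cvec.scale_left_diff_distrib)
  qed
qed

text \<open>An eigenvector of the resolvent is also one of its adjoint, as the resolvent is normal.\<close>

lemma cinner_R_eigenvector:
  assumes "y \<in> eigenspace V T (complex_of_real z)"
  shows "cinner (R x) y = (1 / (complex_of_real z - \<i>)) * cinner x y"
proof -
  have nz: "complex_of_real z - \<i> \<noteq> 0"
    by (auto simp: complex_eq_iff)
  have y: "y \<in> V" "T y = complex_of_real z *\<^sub>C y"
    using assms by (auto simp: eigenspace_def)
  have "cinner x y = cinner (T (R x) - \<i> *\<^sub>C R x) y"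
    by (simp only: R_inverse(2))
  also have "\<dots> = (complex_of_real z - \<i>) * cinner (R x) y"
    using symmetric[OF R_inverse(1) y(1), of x] y(2)
    by (simp add: cinner.diff_left cinner_scaleC_left cinner_scaleC_right algebra_simps)
  finally show ?thesis
    using nz by simp
qed

lemma eigenvectors_orthogonal:
  assumes "x \<in> eigenspace V T (complex_of_real w)" "y \<in> eigenspace V T (complex_of_real z)" "w \<noteq> z"
  shows "cinner x y = 0"
proof -
  have "complex_of_real w * cinner x y = complex_of_real z * cinner x y"
    using symmetric[of x y] assms(1,2)
    by (simp add: eigenspace_def cinner_scaleC_left cinner_scaleC_right)
  then show ?thesis
    using assms(3) by simp
qed

text \<open>Compactness passes from one resolvent to another by the resolvent identity.\<close>

lemma compact_R:
  assumes "has_compact_resolvent V T"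
  shows "compact_operator R"
  unfolding compact_operator_def
proof (intro allI impI)
  obtain z where z: "z \<in> resolvent_set V T" "compact_operator (resolvent V T z)"
    using assms by (auto simp: has_compact_resolvent_def)
  fix B :: "'a set" assume "bounded B"
  then obtain C where C: "\<And>f. f \<in> B \<Longrightarrow> norm f \<le> C"
    by (auto simp: bounded_iff)
  define B' where "B' = (\<lambda>f. f + (\<i> - z) *\<^sub>C R f) ` B"
  have "norm (f + (\<i> - z) *\<^sub>C R f) \<le> C + cmod (\<i> - z) * C" if "f \<in> B" for f
  proof -
    have "cmod (\<i> - z) * norm (R f) \<le> cmod (\<i> - z) * C"
      using C[OF that] norm_R_apply_le[of f] by (intro mult_left_mono) auto
    then show ?thesis
      using norm_triangle_ineq[of f "(\<i> - z) *\<^sub>C R f"] C[OF that] by (simp add: norm_scaleC)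
  qed
  then have "bounded B'"
    by (auto simp: B'_def bounded_iff)
  then have "compact (closure (resolvent V T z ` B'))"
    using z(2) by (simp add: compact_operator_def)
  moreover have "R ` B \<subseteq> resolvent V T z ` B'"
  proof -
    have "R f = resolvent V T z (f + (\<i> - z) *\<^sub>C R f)" for f
    proof -
      have "f + (\<i> - z) *\<^sub>C R f = T (R f) - z *\<^sub>C R f"
        using R_inverse(2)[of f] by (simp add: cvec.scale_left_diff_distrib algebra_simps)
      then show ?thesis
        by (simp only: resolvent_inverse(3)[OF z(1) R_inverse(1)])
    qed
    then show ?thesis
      by (auto simp: B'_def)
  qed
  ultimately show "compact (closure (R ` B))"
    using compact_Int_closed[OF _ closed_closure, of "closure (resolvent V T z ` B')" "R ` B"]
    by (simp add: Int_absorb1 closure_mono)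
qed

end

section \<open>Differentiability of the resolvent\<close>

text \<open>
  Banach--Steinhaus: by Baire's theorem one of the closed sets of points at which the whole family
  is bounded by \<open>n\<close> contains a ball.
\<close>

lemma uniform_boundedness:
  fixes f :: "'i \<Rightarrow> 'a::banach \<Rightarrow> 'b::real_normed_vector"
  assumes lin: "\<And>j. j \<in> J \<Longrightarrow> bounded_linear (f j)"
    and pw: "\<And>x. \<exists>C. \<forall>j\<in>J. norm (f j x) \<le> C"
  shows "\<exists>C\<ge>0. \<forall>j\<in>J. \<forall>x. norm (f j x) \<le> C * norm x"
proof -
  define F where "F n = {x. \<forall>j\<in>J. norm (f j x) \<le> real n}" for n
  have closed_F: "closed (F n)" for n
  proof -
    have "F n = (\<Inter>j\<in>J. {x. norm (f j x) \<le> real n})"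
      by (auto simp: F_def)
    moreover have "closed {x. norm (f j x) \<le> real n}" if "j \<in> J" for j
      using lin[OF that]
      by (intro closed_Collect_le continuous_intros linear_continuous_on)
    ultimately show ?thesis by auto
  qed
  have "\<Union>(range F) = UNIV"
  proof -
    have "\<exists>n. x \<in> F n" for x
    proof -
      obtain C where "\<forall>j\<in>J. norm (f j x) \<le> C" using pw by blast
      moreover obtain n where "C \<le> real n" using real_arch_simple by blast
      ultimately have "x \<in> F n"
        unfolding F_def by (blast intro: order_trans)
      then show ?thesis ..
    qed
    then show ?thesis by blast
  qed
  have "\<exists>n. interior (F n) \<noteq> {}"
  proof (rule ccontr)
    assume "\<not> ?thesis"
    then have "Met_TC.mtopology interior_of \<Union>(range F) = {}"
      using closed_F
      by (intro Met_TC.metric_Baire_category_alt)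
        (auto simp: complete_UNIV)
    then show False
      using \<open>\<Union>(range F) = UNIV\<close> by simp
  qed
  then obtain n a where "a \<in> interior (F n)" by blast
  then obtain r where r: "r > 0" "cball a r \<subseteq> F n"
    by (meson interior_subset mem_interior_cball subset_trans)
  have "norm (f j x) \<le> (2 * real n / r) * norm x" if "j \<in> J" for j x
  proof (cases "x = 0")
    case True
    then show ?thesis
      using bounded_linear.linear[OF lin[OF that]] by (simp add: linear_0)
  next
    case False
    interpret f: bounded_linear "f j" by (rule lin[OF that])
    define y where "y = (r / norm x) *\<^sub>R x"
    have "norm y = r"
      using False r(1) by (simp add: y_def)
    then have "a + y \<in> F n" "a \<in> F n"
      using r by (auto simp: subset_iff dist_norm)
    then have "norm (f j y) \<le> 2 * real n"
      using norm_triangle_ineq4[of "f j (a + y)" "f j a"] that by (force simp: F_def f.add)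
    moreover have "norm (f j y) = (r / norm x) * norm (f j x)"
      using r(1) by (simp add: y_def f.scaleR)
    ultimately show ?thesis
      using False r(1) by (simp add: field_simps)
  qed
  then show ?thesis
    using r(1) by (intro exI[of _ "2 * real n / r"]) auto
qed

lemma weakly_bounded_imp_bounded:
  fixes X :: "'i \<Rightarrow> 'a::complex_hilbert_space"
  assumes "\<And>v. \<exists>C. \<forall>j\<in>J. cmod (cinner (X j) v) \<le> C"
  shows "\<exists>C. \<forall>j\<in>J. norm (X j) \<le> C"
proof -
  obtain C where C: "C \<ge> 0" "\<forall>j\<in>J. \<forall>v. cmod (cinner (X j) v) \<le> C * norm v"
    using uniform_boundedness[of J "\<lambda>j. cinner (X j)", OF cinner.bounded_linear_right assms] by blast
  then have "norm (X j) \<le> C" if "j \<in> J" for j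
    using norm_le_if_cinner_le_on_dense[of UNIV C "X j"] that by simp
  then show ?thesis by blast
qed

text \<open>
  A weakly bounded family of symmetric operators on the domain is bounded in the graph norm: the
  vectors \<open>D j u\<close> are bounded for each \<open>u\<close>, and by symmetry the functionals
  \<open>f \<mapsto> \<langle>D j (R f), v\<rangle> = \<langle>R f, D j v\<rangle>\<close> are continuous, so that uniform boundedness applies again.
\<close>

lemma (in self_adjoint) symmetric_family_bounded:
  fixes D :: "'i \<Rightarrow> 'a \<Rightarrow> 'a"
  assumes sym: "\<And>j u v. j \<in> J \<Longrightarrow> u \<in> V \<Longrightarrow> v \<in> V \<Longrightarrow> cinner (D j u) v = cinner u (D j v)"
    and weak: "\<And>u v. u \<in> V \<Longrightarrow> \<exists>C. \<forall>j\<in>J. cmod (cinner (D j u) v) \<le> C"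
  shows "\<exists>C\<ge>0. \<forall>j\<in>J. \<forall>f. norm (D j (R f)) \<le> C * norm f"
proof -
  define \<phi> where "\<phi> = (\<lambda>(j, v) f. cinner (R f) (D j v) /\<^sub>R norm v)"
  define I where "I = J \<times> (V - {0})"
  have lin: "bounded_linear (\<phi> i)" for i
    by (cases i) (auto simp: \<phi>_def
        intro!: bounded_linear_scaleR_right[THEN bounded_linear_compose]
          cinner.bounded_linear_left[THEN bounded_linear_compose] blinfun.bounded_linear_right)
  have \<phi>_eq: "norm (\<phi> (j, v) f) = cmod (cinner (D j (R f)) v) / norm v" if "(j, v) \<in> I" for j v f
    using that by (simp add: \<phi>_def I_def sym[OF _ R_inverse(1)] divide_inverse_commute)
  have pw: "\<exists>C. \<forall>i\<in>I. norm (\<phi> i f) \<le> C" for f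
  proof -
    obtain C where C: "\<forall>j\<in>J. norm (D j (R f)) \<le> C"
      using weakly_bounded_imp_bounded[of J "\<lambda>j. D j (R f)", OF weak[OF R_inverse(1)]] by blast
    have "norm (\<phi> (j, v) f) \<le> C" if "(j, v) \<in> I" for j v
    proof -
      have "norm (\<phi> (j, v) f) \<le> norm (D j (R f)) * norm v / norm v"
        unfolding \<phi>_eq[OF that] by (intro divide_right_mono cmod_cinner_le) auto
      also have "\<dots> \<le> C"
        using that C by (auto simp: I_def)
      finally show ?thesis .
    qed
    then show ?thesis by (metis surj_pair)
  qed
  obtain C where C: "C \<ge> 0" "\<forall>i\<in>I. \<forall>f. norm (\<phi> i f) \<le> C * norm f"
    using uniform_boundedness[of I \<phi>, OF lin pw] by blast
  have "norm (D j (R f)) \<le> C * norm f" if j: "j \<in> J" for j f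
  proof (rule norm_le_if_cinner_le_on_dense[OF dense])
    fix v assume v: "v \<in> V"
    show "cmod (cinner (D j (R f)) v) \<le> C * norm f * norm v"
    proof (cases "v = 0")
      case False
      then have "(j, v) \<in> I" using j v by (simp add: I_def)
      then have "cmod (cinner (D j (R f)) v) / norm v \<le> C * norm f"
        using C(2) \<phi>_eq by metis
      then show ?thesis
        using False by (simp add: field_simps)
    qed (simp add: cinner.zero_right)
  qed (use C in auto)
  then show ?thesis using C(1) by blast
qed

text \<open>
  The derivative at \<open>t\<close> is approximated by difference quotients with an explicit rate. Unlike
  convergence without a rate, this turns into a boundedness statement, to which uniform boundedness
  applies.
\<close>

lemma C1_Holder_difference_quotient:
  assumes "C1_Holder \<alpha> f" "\<alpha> > 0"
  shows "\<exists>d C. 0 \<le> C \<and> (\<forall>h. 0 < \<bar>h\<bar> \<longrightarrow> \<bar>h\<bar> \<le> 1 \<longrightarrow>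
    norm ((f (t + h) - f t) /\<^sub>R h - d) \<le> C * \<bar>h\<bar> powr \<alpha>)"
proof -
  obtain f' where f': "\<And>t. (f has_vector_derivative f' t) (at t)"
    and bdd: "\<And>a b. bounded {(f' t - f' s) /\<^sub>R (\<bar>t - s\<bar> powr \<alpha>) | t s.
        t \<in> {a..b} \<and> s \<in> {a..b} \<and> t \<noteq> s}"
    using assms(1) by (auto simp: C1_Holder_def)
  obtain C where C: "C > 0" "\<And>x. x \<in> {(f' t' - f' s) /\<^sub>R (\<bar>t' - s\<bar> powr \<alpha>) | t' s.
        t' \<in> {t-1..t+1} \<and> s \<in> {t-1..t+1} \<and> t' \<noteq> s} \<Longrightarrow> norm x \<le> C"
    using bdd[of "t - 1" "t + 1"] by (meson bounded_pos)
  have Holder: "norm (f' x - f' t) \<le> C * \<bar>x - t\<bar> powr \<alpha>" if "\<bar>x - t\<bar> \<le> 1" for x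
  proof (cases "x = t")
    case False
    have "norm ((f' x - f' t) /\<^sub>R (\<bar>x - t\<bar> powr \<alpha>)) \<le> C"
      using that False by (intro C(2) CollectI exI[of _ x] exI[of _ t]) auto
    then have "norm (f' x - f' t) / \<bar>x - t\<bar> powr \<alpha> \<le> C"
      by (simp add: divide_inverse_commute)
    then show ?thesis
      using False by (simp add: pos_divide_le_eq)
  qed simp
  have "norm ((f (t + h) - f t) /\<^sub>R h - f' t) \<le> C * \<bar>h\<bar> powr \<alpha>" if h: "0 < \<bar>h\<bar>" "\<bar>h\<bar> \<le> 1" for h
  proof -
    have "norm (f (t + h) - f t - (t + h - t) *\<^sub>R f' t) \<le> norm (t + h - t) * (C * \<bar>h\<bar> powr \<alpha>)"
    proof (rule vector_differentiable_bound_linearization[where S = "closed_segment t (t + h)"])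
      fix x assume "x \<in> closed_segment t (t + h)"
      then have x: "\<bar>x - t\<bar> \<le> \<bar>h\<bar>"
        using segment_bound(1)[of x t "t + h"] by simp
      then have "C * \<bar>x - t\<bar> powr \<alpha> \<le> C * \<bar>h\<bar> powr \<alpha>"
        using C(1) assms(2) by (intro mult_left_mono powr_mono2) auto
      then show "norm (f' x - f' t) \<le> C * \<bar>h\<bar> powr \<alpha>"
        using Holder[of x] x h by linarith
    qed (auto intro: f' has_vector_derivative_at_within)
    moreover have "(f (t + h) - f t) /\<^sub>R h - f' t = (f (t + h) - f t - (t + h - t) *\<^sub>R f' t) /\<^sub>R h"
      using h by (simp add: scaleR_diff_right)
    ultimately have "norm ((f (t + h) - f t) /\<^sub>R h - f' t) \<le> inverse \<bar>h\<bar> * (\<bar>h\<bar> * (C * \<bar>h\<bar> powr \<alpha>))"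
      using h by (simp add: mult_left_mono)
    then show ?thesis
      using h(1) by (simp flip: mult.assoc)
  qed
  then show ?thesis
    using C(1) by (intro exI[of _ "f' t"] exI[of _ C]) auto
qed

lemma difference_quotient_tendsto:
  fixes f :: "real \<Rightarrow> 'b::real_normed_vector"
  assumes "(f has_vector_derivative D) (at t)"
  shows "((\<lambda>s. (f s - f t) /\<^sub>R (s - t)) \<longlongrightarrow> D) (at t)"
proof -
  have "((\<lambda>s. norm (f s - f t - (s - t) *\<^sub>R D) / norm (s - t)) \<longlongrightarrow> 0) (at t)"
    using assms by (simp add: has_vector_derivative_def has_derivative_iff_norm)
  moreover have "norm (f s - f t - (s - t) *\<^sub>R D) / norm (s - t)
      = norm ((f s - f t) /\<^sub>R (s - t) - D)" if "s \<noteq> t" for s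
  proof -
    have "(f s - f t) /\<^sub>R (s - t) - D = (f s - f t - (s - t) *\<^sub>R D) /\<^sub>R (s - t)"
      using that by (simp add: scaleR_diff_right)
    then show ?thesis
      by (simp add: divide_inverse_commute)
  qed
  ultimately have "((\<lambda>s. norm ((f s - f t) /\<^sub>R (s - t) - D)) \<longlongrightarrow> 0) (at t)"
    by (subst tendsto_cong[where g = "\<lambda>s. norm (f s - f t - (s - t) *\<^sub>R D) / norm (s - t)"])
      (auto simp: eventually_at_filter)
  then show ?thesis
    using LIM_zero_cancel tendsto_norm_zero_iff by blast
qed

text \<open>
  The natural domain contains the line \<open>z = \<i>\<close>, along which the joint derivative is restricted.
\<close>

lemma C1_resolvent_differentiable:
  fixes A :: "real \<Rightarrow> 'a::complex_hilbert_space \<Rightarrow> 'a"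
  assumes sa: "\<And>t. self_adjoint V (A t)" and "C1_resolvent V A"
  shows "\<exists>R1. ((\<lambda>s. (resolvent V (A s) \<i> - resolvent V (A t) \<i>) /\<^sub>R (s - t)) \<longlongrightarrow> R1) (at t)"
proof -
  let ?G = "global_resolvent_set V A"
  obtain R' :: "real \<times> complex \<Rightarrow> (real \<times> complex) \<Rightarrow>\<^sub>L ('a \<Rightarrow>\<^sub>L 'a)" where
    R': "\<forall>p\<in>?G. ((\<lambda>(t, z). resolvent V (A t) z) has_derivative blinfun_apply (R' p)) (at p within ?G)"
    using assms(2) by (auto simp: C1_resolvent_def)
  have G: "(s, \<i>) \<in> ?G" for s
    using self_adjoint.imaginary_unit_in_resolvent_set[OF sa]
    by (simp add: global_resolvent_set_def)
  have "((\<lambda>(t, z). resolvent V (A t) z) has_derivative blinfun_apply (R' (t, \<i>)))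
      (at (t, \<i>) within range (\<lambda>s. (s, \<i>)))"
    using R' G by (auto intro: has_derivative_subset)
  moreover have "((\<lambda>s. (s, \<i>)) has_derivative (\<lambda>h. (h, 0))) (at t)"
    by (auto intro!: derivative_eq_intros)
  ultimately have "((\<lambda>s. resolvent V (A s) \<i>) has_derivative (\<lambda>h. R' (t, \<i>) (h, 0))) (at t)"
    using has_derivative_in_compose[of "\<lambda>s. (s, \<i>)" "\<lambda>h. (h, 0)" t UNIV
        "\<lambda>(t, z). resolvent V (A t) z" "blinfun_apply (R' (t, \<i>))"] by simp
  moreover have "(\<lambda>h. R' (t, \<i>) (h, 0)) = (\<lambda>h. h *\<^sub>R R' (t, \<i>) (1, 0))"
  proof
    show "R' (t, \<i>) (h, 0) = h *\<^sub>R R' (t, \<i>) (1, 0)" for h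
      using blinfun.scaleR_right[of "R' (t, \<i>)" h "(1, 0)"] by simp
  qed
  ultimately have "((\<lambda>s. resolvent V (A s) \<i>) has_vector_derivative R' (t, \<i>) (1, 0)) (at t)"
    by (simp only: has_vector_derivative_def)
  then show ?thesis
    using difference_quotient_tendsto by blast
qed

text \<open>
  Let \<open>D h = (A (t + h) - A t) / h\<close>. Weak regularity bounds \<open>D h\<close>, and also \<open>D h - D k\<close> divided by
  \<open>\<bar>h\<bar> powr \<alpha> + \<bar>k\<bar> powr \<alpha>\<close>, weakly on the domain; both families are symmetric, so after composition with
  the resolvent they are bounded in norm. As the difference quotient of the resolvent is
  \<open>- R (t + h) (D h) (R t)\<close>, it satisfies the Cauchy criterion in the operator norm.
\<close>

lemma C1_Holder_curve_resolvent_differentiable: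
  fixes A :: "real \<Rightarrow> 'a::complex_hilbert_space \<Rightarrow> 'a"
  assumes sa: "\<And>t. self_adjoint V (A t)" and curve: "C1_Holder_curve \<alpha> V A" and "\<alpha> > 0"
  shows "\<exists>R1. ((\<lambda>s. (resolvent V (A s) \<i> - resolvent V (A t) \<i>) /\<^sub>R (s - t)) \<longlongrightarrow> R1) (at t)"
proof -
  interpret T: self_adjoint V "A t" by (rule sa)
  interpret Th: self_adjoint V "A (t + h)" for h by (rule sa)
  define J :: "real set" where "J = {h. 0 < \<bar>h\<bar> \<and> \<bar>h\<bar> \<le> 1}"
  define D where "D h u = (A (t + h) u - A t u) /\<^sub>R h" for h u
  define D2 where "D2 = (\<lambda>(h, k) u. (D h u - D k u) /\<^sub>R (\<bar>h\<bar> powr \<alpha> + \<bar>k\<bar> powr \<alpha>))"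
  have D_sym: "cinner (D h u) v = cinner u (D h v)" if "u \<in> V" "v \<in> V" for h u v
    using that
    by (simp add: D_def cinner_scaleR_left cinner_scaleR_right cinner.diff_left cinner.diff_right
        T.symmetric Th.symmetric)
  have weak: "\<exists>d C. 0 \<le> C \<and> (\<forall>h\<in>J. cmod (cinner (D h u) v - d) \<le> C * \<bar>h\<bar> powr \<alpha>)" if "u \<in> V" for u v
    using C1_Holder_difference_quotient[of \<alpha> "\<lambda>t. cinner (A t u) v" t] curve that \<open>\<alpha> > 0\<close>
    by (simp add: C1_Holder_curve_def J_def D_def cinner_scaleR_left cinner.diff_left
        Ball_def imp_conjL del: zero_less_abs_iff)
  have "\<exists>C\<ge>0. \<forall>h\<in>J. \<forall>f. norm (D h (T.R f)) \<le> C * norm f"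
  proof (rule T.symmetric_family_bounded[OF D_sym])
    fix u v assume "u \<in> V"
    then obtain d C where C: "0 \<le> C" "\<forall>h\<in>J. cmod (cinner (D h u) v - d) \<le> C * \<bar>h\<bar> powr \<alpha>"
      using weak by blast
    have "cmod (cinner (D h u) v) \<le> C + cmod d" if "h \<in> J" for h
    proof -
      have "\<bar>h\<bar> powr \<alpha> \<le> 1"
        using that \<open>\<alpha> > 0\<close> by (auto simp: J_def intro: powr_le1)
      then have "C * \<bar>h\<bar> powr \<alpha> \<le> C"
        using C(1) by (simp add: mult_left_le)
      then have "cmod (cinner (D h u) v - d) \<le> C"
        using C(2) that by fastforce
      then show ?thesis
        using norm_triangle_sub[of "cinner (D h u) v" d] by linarith
    qed
    then show "\<exists>C. \<forall>h\<in>J. cmod (cinner (D h u) v) \<le> C" by blast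
  qed
  then obtain C1 where C1: "C1 \<ge> 0" "\<And>h f. h \<in> J \<Longrightarrow> norm (D h (T.R f)) \<le> C1 * norm f" by blast
  have pos: "\<bar>h\<bar> powr \<alpha> + \<bar>k\<bar> powr \<alpha> > 0" if "h \<in> J" for h k
    using that by (auto simp: J_def intro: add_pos_nonneg)
  have "\<exists>C\<ge>0. \<forall>i\<in>J\<times>J. \<forall>f. norm (D2 i (T.R f)) \<le> C * norm f"
  proof (rule T.symmetric_family_bounded)
    fix i u v assume "i \<in> J \<times> J" "u \<in> V" "v \<in> V"
    then show "cinner (D2 i u) v = cinner u (D2 i v)"
      by (auto simp: D2_def cinner_scaleR_left cinner_scaleR_right cinner.diff_left
          cinner.diff_right D_sym)
  next
    fix u v assume "u \<in> V"
    then obtain d C where C: "0 \<le> C" "\<forall>h\<in>J. cmod (cinner (D h u) v - d) \<le> C * \<bar>h\<bar> powr \<alpha>"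
      using weak by blast
    have "cmod (cinner (D2 (h, k) u) v) \<le> C" if "h \<in> J" "k \<in> J" for h k
    proof -
      have "cmod (cinner (D h u) v - cinner (D k u) v)
          \<le> cmod (cinner (D h u) v - d) + cmod (cinner (D k u) v - d)"
        using norm_triangle_ineq4[of "cinner (D h u) v - d" "cinner (D k u) v - d"] by simp
      also have "\<dots> \<le> C * (\<bar>h\<bar> powr \<alpha> + \<bar>k\<bar> powr \<alpha>)"
        using C(2) that by (simp add: distrib_left add_mono)
      finally have "cmod (cinner (D h u - D k u) v) / (\<bar>h\<bar> powr \<alpha> + \<bar>k\<bar> powr \<alpha>) \<le> C"
        using pos[OF that(1), of k] by (simp add: cinner.diff_left pos_divide_le_eq)
      then show ?thesis
        using pos[OF that(1), of k]
        by (simp add: D2_def cinner_scaleR_left divide_inverse_commute abs_of_pos)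
    qed
    then show "\<exists>C. \<forall>i\<in>J\<times>J. cmod (cinner (D2 i u) v) \<le> C" by auto
  qed
  then obtain C2 where C2: "C2 \<ge> 0" "\<And>i f. i \<in> J \<times> J \<Longrightarrow> norm (D2 i (T.R f)) \<le> C2 * norm f" by blast
  have D_diff: "norm (D h (T.R f) - D k (T.R f)) \<le> C2 * (\<bar>h\<bar> powr \<alpha> + \<bar>k\<bar> powr \<alpha>) * norm f"
    if "h \<in> J" "k \<in> J" for h k f
  proof -
    have "norm (D h (T.R f) - D k (T.R f)) / (\<bar>h\<bar> powr \<alpha> + \<bar>k\<bar> powr \<alpha>) \<le> C2 * norm f"
      using C2(2)[of "(h, k)" f] pos[OF that(1), of k] that
      by (simp add: D2_def divide_inverse_commute abs_of_pos)
    then show ?thesis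
      using pos[OF that(1), of k] by (simp add: pos_divide_le_eq mult_ac)
  qed
  have R_eq: "Th.R h f - T.R f = - (h *\<^sub>R Th.R h (D h (T.R f)))" if "h \<in> J" for h f
  proof -
    have "A (t + h) (T.R f) - \<i> *\<^sub>C T.R f = f + h *\<^sub>R D h (T.R f)"
      using T.R_inverse(2)[of f] that by (simp add: D_def J_def algebra_simps)
    then have "T.R f = Th.R h (f + h *\<^sub>R D h (T.R f))"
      using Th.R_inverse(3)[OF T.R_inverse(1)[of f], of h] by simp
    then have "T.R f = Th.R h f + h *\<^sub>R Th.R h (D h (T.R f))"
      by (simp only: blinfun.add_right blinfun.scaleR_right)
    then show ?thesis
      by (metis add_diff_cancel_left' minus_diff_eq)
  qed
  define Q where "Q h = (Th.R h - T.R) /\<^sub>R h" for h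
  have Q_apply: "Q h f = - Th.R h (D h (T.R f))" if "h \<in> J" for h f
    using R_eq[OF that, of f] that
    by (simp add: Q_def blinfun.scaleR_left blinfun.diff_left J_def)
  have R_diff: "norm (Th.R h f - T.R f) \<le> \<bar>h\<bar> * C1 * norm f" if "h \<in> J" for h f
  proof -
    have "norm (Th.R h (D h (T.R f))) \<le> C1 * norm f"
      using Th.norm_R_apply_le C1(2)[OF that] by (rule order_trans)
    then show ?thesis
      unfolding R_eq[OF that] by (simp add: mult_left_mono mult.assoc)
  qed
  define g where "g h = C2 * \<bar>h\<bar> powr \<alpha> + C1 * C1 * \<bar>h\<bar>" for h
  have Q_diff: "norm (Q h - Q k) \<le> g h + g k" if "h \<in> J" "k \<in> J" for h k
  proof (rule norm_blinfun_bound)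
    show "0 \<le> g h + g k"
      using C1(1) C2(1) by (simp add: g_def)
    fix f
    let ?w = "D k (T.R f)"
    have tri: "norm (- a - b + c) \<le> norm a + norm b + norm c" for a b c :: 'a
      using norm_triangle_ineq[of "- a - b" c] norm_triangle_ineq4[of "- a" b] by simp
    have "norm ((Q h - Q k) f) = norm (- Th.R h (D h (T.R f) - ?w) - (Th.R h ?w - T.R ?w) + (Th.R k ?w - T.R ?w))"
      using that by (simp add: Q_apply blinfun.diff_left blinfun.diff_right)
    also have "\<dots> \<le> norm (Th.R h (D h (T.R f) - ?w)) + norm (Th.R h ?w - T.R ?w)
        + norm (Th.R k ?w - T.R ?w)"
      by (rule tri)
    also have "\<dots> \<le> C2 * (\<bar>h\<bar> powr \<alpha> + \<bar>k\<bar> powr \<alpha>) * norm f + \<bar>h\<bar> * C1 * norm ?w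
        + \<bar>k\<bar> * C1 * norm ?w"
      by (intro add_mono order_trans[OF Th.norm_R_apply_le D_diff[OF that]] R_diff[OF that(1)]
          R_diff[OF that(2)])
    also have "\<dots> \<le> C2 * (\<bar>h\<bar> powr \<alpha> + \<bar>k\<bar> powr \<alpha>) * norm f + \<bar>h\<bar> * C1 * (C1 * norm f)
        + \<bar>k\<bar> * C1 * (C1 * norm f)"
      by (rule add_mono[OF add_mono[OF order_refl mult_left_mono] mult_left_mono])
        (use C1 that in auto)
    also have "\<dots> = (g h + g k) * norm f"
      by (simp add: g_def algebra_simps)
    finally show "norm ((Q h - Q k) f) \<le> (g h + g k) * norm f" .
  qed
  have g_lim: "(g \<longlongrightarrow> 0) (at 0)"
  proof -
    have "((\<lambda>h. C2 * \<bar>h\<bar> powr \<alpha> + C1 * C1 * \<bar>h\<bar>) \<longlongrightarrow> C2 * 0 + C1 * C1 * \<bar>0\<bar>) (at 0)"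
      using \<open>\<alpha> > 0\<close> by (intro tendsto_intros tendsto_zero_powrI[where b = \<alpha>]) (auto intro!: tendsto_eq_intros)
    then show ?thesis by (simp add: g_def[abs_def])
  qed
  define k where "k n = 1 / real (Suc n)" for n
  have kJ: "k n \<in> J" for n
    by (simp add: k_def J_def)
  have "k \<longlonglongrightarrow> 0"
    unfolding k_def using LIMSEQ_inverse_real_of_nat by (simp add: inverse_eq_divide)
  then have "filterlim k (at 0) sequentially"
    using kJ by (auto simp: filterlim_at J_def)
  then have gk: "(\<lambda>n. g (k n)) \<longlonglongrightarrow> 0"
    by (rule filterlim_compose[OF g_lim])
  have "Cauchy (\<lambda>n. Q (k n))"
  proof (rule metric_CauchyI)
    fix e :: real assume "e > 0"
    then obtain N where N: "\<And>n. n \<ge> N \<Longrightarrow> g (k n) < e / 2"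
      using order_tendstoD(2)[OF gk, of "e / 2"] by (auto simp: eventually_sequentially)
    have "dist (Q (k m)) (Q (k n)) < e" if "m \<ge> N" "n \<ge> N" for m n
      using Q_diff[OF kJ kJ, of m n] N[OF that(1)] N[OF that(2)] by (simp add: dist_norm)
    then show "\<exists>N. \<forall>m\<ge>N. \<forall>n\<ge>N. dist (Q (k m)) (Q (k n)) < e" by blast
  qed
  then obtain R1 where R1: "(\<lambda>n. Q (k n)) \<longlonglongrightarrow> R1"
    using Cauchy_convergent convergent_def by blast
  have "norm (Q h - R1) \<le> g h" if "h \<in> J" for h
  proof (rule LIMSEQ_le)
    show "(\<lambda>n. norm (Q h - Q (k n))) \<longlonglongrightarrow> norm (Q h - R1)"
      by (intro tendsto_intros R1)
    show "(\<lambda>n. g h + g (k n)) \<longlonglongrightarrow> g h"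
      using tendsto_add[OF tendsto_const gk, of "g h"] by simp
  qed (use Q_diff[OF that kJ] in blast)
  moreover have "eventually (\<lambda>h. h \<in> J) (at 0)"
    by (auto simp: eventually_at J_def intro!: exI[of _ 1])
  ultimately have "eventually (\<lambda>h. norm (Q h - R1) \<le> norm (g h)) (at 0)"
    by (auto elim!: eventually_mono intro: order_trans[OF _ abs_ge_self])
  then have "(Q \<longlongrightarrow> R1) (at 0)"
    by (rule LIM_zero_cancel[OF Lim_transform_bound[OF _ g_lim]])
  moreover have "filterlim (\<lambda>s. s - t) (at 0) (at t)"
    by (auto simp: filterlim_at eventually_at_filter intro!: tendsto_eq_intros)
  ultimately have "((\<lambda>s. Q (s - t)) \<longlongrightarrow> R1) (at t)"
    by (rule filterlim_compose)
  then show ?thesis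
    by (auto simp: Q_def)
qed

section \<open>Eigenvalue curves along a sequence of parameters\<close>

lemma common_convergent_subsequence:
  fixes f :: "'i \<Rightarrow> nat \<Rightarrow> 'b::topological_space"
  assumes "finite S"
    and "\<And>i \<sigma>. i \<in> S \<Longrightarrow> strict_mono \<sigma> \<Longrightarrow> \<exists>\<sigma>' :: nat \<Rightarrow> nat. strict_mono \<sigma>' \<and> convergent (\<lambda>n. f i (\<sigma> (\<sigma>' n)))"
  shows "\<exists>\<sigma> :: nat \<Rightarrow> nat. strict_mono \<sigma> \<and> (\<forall>i\<in>S. convergent (\<lambda>n. f i (\<sigma> n)))"
  using assms
proof (induction S rule: finite_induct)
  case empty
  show ?case by (rule exI[of _ id]) (simp add: strict_mono_def)
next
  case (insert i S)
  then obtain \<sigma> where \<sigma>: "strict_mono \<sigma>" "\<And>j. j \<in> S \<Longrightarrow> convergent (\<lambda>n. f j (\<sigma> n))"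
    by (metis insertCI)
  obtain \<sigma>' where \<sigma>': "strict_mono \<sigma>'" "convergent (\<lambda>n. f i (\<sigma> (\<sigma>' n)))"
    using insert(4)[OF insertI1 \<sigma>(1)] by blast
  have "convergent (\<lambda>n. f j (\<sigma> (\<sigma>' n)))" if "j \<in> S" for j
    using convergent_subseq_convergent[OF \<sigma>(2)[OF that] \<sigma>'(1)] by (simp add: o_def)
  then show ?case
    using strict_mono_o[OF \<sigma>(1) \<sigma>'(1)] \<sigma>'(2)
    by (intro exI[of _ "\<lambda>n. \<sigma> (\<sigma>' n)"]) (simp add: o_def)
qed

locale eigenvalue_curves =
  fixes V :: "'a::complex_hilbert_space set"
    and A :: "real \<Rightarrow> 'a \<Rightarrow> 'a"
    and N :: enat
    and l :: "nat \<Rightarrow> real \<Rightarrow> real"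
  assumes self_adjoint_at: "\<And>t. self_adjoint V (A t)"
    and compact_resolvent_at: "\<And>t. has_compact_resolvent V (A t)"
    and continuous_at: "\<And>i. enat i < N \<Longrightarrow> continuous_on UNIV (l i)"
    and parameterizes: "parameterizes_eigenvalues N l V A"
begin

sublocale self_adjoint V "A t" for t
  by (rule self_adjoint_at)

definition level :: "real \<Rightarrow> real \<Rightarrow> nat set"
  where "level t z = {i. enat i < N \<and> l i t = z}"

text \<open>
  Each eigenspace has room for as many orthonormal vectors as there are indices in \<open>S\<close> with that
  eigenvalue, and different eigenspaces are orthogonal.
\<close>

lemma orthonormal_eigenvectors:
  assumes "finite S" "\<And>i. i \<in> S \<Longrightarrow> enat i < N"
  shows "\<exists>x. orthonormal_on S x \<and> (\<forall>i\<in>S. x i \<in> eigenspace V (A t) (complex_of_real (l i t)))"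
proof -
  have "\<exists>y. orthonormal_on (S \<inter> level t w) y \<and>
      (\<forall>i\<in>S \<inter> level t w. y i \<in> eigenspace V (A t) (complex_of_real w))" for w
  proof -
    obtain B where B: "cvec.independent B" "cvec.span B = eigenspace V (A t) (complex_of_real w)"
        "level t w \<approx> B"
      using parameterizes unfolding parameterizes_eigenvalues_def level_def by blast
    then obtain g where g: "bij_betw g (level t w) B"
      by (auto simp: eqpoll_def)
    let ?S = "S \<inter> level t w"
    have gS: "g ` ?S \<subseteq> B" "inj_on g ?S"
      using g by (auto simp: bij_betw_def inj_on_def)
    have "finite (g ` ?S)" "cvec.independent (g ` ?S)"
      using assms(1) cvec.independent_mono[OF B(1) gS(1)] by auto
    then obtain e where e: "orthonormal_on (g ` ?S) e" "cvec.span (e ` g ` ?S) = cvec.span (g ` ?S)"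
      using independent_imp_orthonormal_basis by blast
    have "orthonormal_on ?S (e \<circ> g)"
      using e(1) gS(2) by (auto simp: orthonormal_on_def inj_on_def)
    moreover have "e (g i) \<in> eigenspace V (A t) (complex_of_real w)" if "i \<in> ?S" for i
    proof -
      have "e (g i) \<in> cvec.span (g ` ?S)"
        unfolding e(2)[symmetric] using that by (intro cvec.span_base imageI)
      then show ?thesis
        using cvec.span_mono[OF gS(1)] B(2) by blast
    qed
    ultimately show ?thesis by (intro exI[of _ "e \<circ> g"]) auto
  qed
  then obtain Y where Y: "\<And>w. orthonormal_on (S \<inter> level t w) (Y w)"
      "\<And>w i. i \<in> S \<inter> level t w \<Longrightarrow> Y w i \<in> eigenspace V (A t) (complex_of_real w)"
    by metis
  have lev: "i \<in> S \<inter> level t (l i t)" if "i \<in> S" for i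
    using that assms(2) by (simp add: level_def)
  define x where "x i = Y (l i t) i" for i
  have x: "x i \<in> eigenspace V (A t) (complex_of_real (l i t))" if "i \<in> S" for i
    using Y(2)[OF lev[OF that]] by (simp add: x_def)
  have "cinner (x i) (x j) = (if i = j then 1 else 0)" if "i \<in> S" "j \<in> S" for i j
  proof (cases "l i t = l j t")
    case True
    then show ?thesis
      using orthonormal_onD[OF Y(1)[of "l i t"], of i j] lev[OF that(1)] lev[OF that(2)]
      by (simp add: x_def)
  next
    case False
    then show ?thesis
      using eigenvectors_orthogonal[OF x[OF that(1)] x[OF that(2)]] by auto
  qed
  then show ?thesis
    using x by (intro exI[of _ x]) (simp add: orthonormal_on_def)
qed

lemma resolvent_eigenvalue:
  assumes "x \<in> eigenspace V (A t) (complex_of_real z)"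
  shows "R t x = (1 / (complex_of_real z - \<i>)) *\<^sub>C x"
  using assms by (simp add: eigenspace_iff_R)

text \<open>
  Otherwise the compact resolvent would map arbitrarily many orthonormal eigenvectors to multiples
  by the same nonzero factor, which stay at a fixed distance from each other.
\<close>

lemma finite_level: "finite (level t z)"
proof (rule ccontr)
  assume inf: "infinite (level t z)"
  define \<rho> where "\<rho> = 1 / (complex_of_real z - \<i>)"
  have "complex_of_real z - \<i> \<noteq> 0"
    by (auto simp: complex_eq_iff)
  then have \<rho>: "cmod \<rho> > 0"
    by (simp add: \<rho>_def)
  let ?K = "closure (R t ` cball 0 1)"
  have "compact ?K"
    using compact_R[OF compact_resolvent_at] by (simp add: compact_operator_def)
  then obtain k where k: "finite k" "?K \<subseteq> (\<Union>x\<in>k. ball x (cmod \<rho> / 2))"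
    using \<rho> unfolding compact_eq_totally_bounded by (meson half_gt_zero)
  obtain S where S: "finite S" "card S = Suc (card k)" "S \<subseteq> level t z"
    using infinite_arbitrarily_large[OF inf] by blast
  then obtain x where x: "orthonormal_on S x" "\<And>i. i \<in> S \<Longrightarrow> x i \<in> eigenspace V (A t) (complex_of_real (l i t))"
    using orthonormal_eigenvectors[of S t] by (auto simp: level_def)
  have "\<exists>c\<in>k. \<rho> *\<^sub>C x i \<in> ball c (cmod \<rho> / 2)" if "i \<in> S" for i
  proof -
    have "R t (x i) = \<rho> *\<^sub>C x i"
      using x(2)[OF that] that S(3) by (auto simp: eigenspace_iff_R level_def \<rho>_def)
    moreover have "x i \<in> cball 0 1"
      using orthonormal_on_norm[OF x(1) that] by simp
    ultimately have "\<rho> *\<^sub>C x i \<in> ?K"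
      by (metis closure_subset imageI subsetD)
    then show ?thesis using k(2) by blast
  qed
  then obtain c where c: "\<And>i. i \<in> S \<Longrightarrow> c i \<in> k" "\<And>i. i \<in> S \<Longrightarrow> \<rho> *\<^sub>C x i \<in> ball (c i) (cmod \<rho> / 2)"
    by metis
  have "card (c ` S) < card S"
    using card_mono[OF k(1), of "c ` S"] c(1) S(2) by (simp add: image_subset_iff less_Suc_eq_le)
  then obtain i j where ij: "i \<in> S" "j \<in> S" "i \<noteq> j" "c i = c j"
    using pigeonhole[of c S] by (auto simp: inj_on_def)
  have "cinner (x i - x j) (x i - x j) = 2"
    using orthonormal_onD[OF x(1)] ij by (simp add: cinner.diff_left cinner.diff_right)
  then have "complex_of_real ((norm (x i - x j))\<^sup>2) = complex_of_real 2"
    by (simp add: cinner_self)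
  then have "(norm (x i - x j))\<^sup>2 = 2"
    by (simp only: of_real_eq_iff)
  then have "norm (x i - x j) \<ge> 1"
    by (intro power2_le_imp_le[of 1]) auto
  then have "cmod \<rho> \<le> cmod \<rho> * norm (x i - x j)"
    using \<rho> by simp
  also have "\<dots> = dist (\<rho> *\<^sub>C x i) (\<rho> *\<^sub>C x j)"
    by (simp add: dist_norm norm_scaleC flip: cvec.scale_right_diff_distrib)
  also have "\<dots> < cmod \<rho>"
    using c(2)[OF ij(1)] c(2)[OF ij(2)] ij(4) dist_triangle_half_r[of "c i" "\<rho> *\<^sub>C x i" "cmod \<rho>" "\<rho> *\<^sub>C x j"]
    by (auto simp: ball_def)
  finally show False by simp
qed

lemma eigenspace_basis:
  "\<exists>B. finite B \<and> card B = card (level t z) \<and> cvec.span B = eigenspace V (A t) (complex_of_real z)"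
proof -
  obtain B where B: "cvec.span B = eigenspace V (A t) (complex_of_real z)" "level t z \<approx> B"
    using parameterizes unfolding parameterizes_eigenvalues_def level_def by blast
  moreover have "finite B"
    using B(2) eqpoll_finite_iff finite_level by blast
  ultimately show ?thesis
    using eqpoll_iff_card[OF finite_level] by metis
qed

text \<open>
  The numbers \<open>\<mu> i\<close> are the candidates for the derivatives of the eigenvalues: as \<open>1 / (\<lambda> - \<i>)\<close> has
  derivative \<open>- \<lambda>' / (\<lambda> - \<i>)\<^sup>2\<close>, the factor \<open>(z - \<i>)\<^sup>2\<close> and the sign translate the compression of the
  derivative \<open>R1\<close> of the resolvent to the eigenspace back to the eigenvalues of \<open>A t\<close>.
\<close>

definition diagonalizes :: "real \<Rightarrow> real \<Rightarrow> ('a \<Rightarrow>\<^sub>L 'a) \<Rightarrow> (nat \<Rightarrow> 'a) \<Rightarrow> (nat \<Rightarrow> real) \<Rightarrow> bool"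
  where "diagonalizes t z R1 e \<mu> \<longleftrightarrow>
    orthonormal_on (level t z) e \<and>
    cvec.span (e ` level t z) = eigenspace V (A t) (complex_of_real z) \<and>
    (\<forall>i\<in>level t z. \<forall>j\<in>level t z. (complex_of_real z - \<i>)\<^sup>2 * cinner (R1 (e i)) (e j)
      = (if i = j then - complex_of_real (\<mu> i) else 0))"

text \<open>
  Choose orthonormal eigenvectors \<open>x n i\<close> for \<open>l i (\<tau> n)\<close>. Compactness of the resolvent makes them
  converge along a subsequence, to orthonormal vectors \<open>e i\<close> that fill the eigenspace, since their
  number is its dimension. With \<open>r n i = 1 / (l i (\<tau> n) - \<i>)\<close> and \<open>\<rho> = 1 / (z - \<i>)\<close>, every \<open>y\<close> in the
  eigenspace satisfies \<open>(r n i - \<rho>) \<langle>x n i, y\<rangle> = \<langle>(R (\<tau> n) - R t) (x n i), y\<rangle>\<close>. Division by \<open>\<tau> n - t\<close>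
  gives for \<open>y = e i\<close> the convergence of the difference quotients and for \<open>y = e j\<close> the vanishing of
  the off-diagonal entries.
\<close>

lemma eigenvalue_quotients_subsequence:
  assumes deriv: "((\<lambda>s. (R s - R t) /\<^sub>R (s - t)) \<longlongrightarrow> R1) (at t)"
    and \<tau>: "\<tau> \<longlonglongrightarrow> t" "\<And>n. \<tau> n \<noteq> t"
  shows "\<exists>\<sigma> e \<mu>. strict_mono \<sigma> \<and> diagonalizes t z R1 e \<mu> \<and>
    (\<forall>i\<in>level t z. (\<lambda>n. (l i (\<tau> (\<sigma> n)) - l i t) / (\<tau> (\<sigma> n) - t)) \<longlonglongrightarrow> \<mu> i)"
proof -
  let ?S = "level t z"
  have S: "finite ?S" "\<And>i. i \<in> ?S \<Longrightarrow> enat i < N" "\<And>i. i \<in> ?S \<Longrightarrow> l i t = z"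
    using finite_level by (auto simp: level_def)
  have nz: "complex_of_real w - \<i> \<noteq> 0" for w
    by (auto simp: complex_eq_iff)
  define \<rho> where "\<rho> = 1 / (complex_of_real z - \<i>)"
  obtain x where x: "\<And>n. orthonormal_on ?S (x n)"
      "\<And>n i. i \<in> ?S \<Longrightarrow> x n i \<in> eigenspace V (A (\<tau> n)) (complex_of_real (l i (\<tau> n)))"
    using orthonormal_eigenvectors[OF S(1,2), of "\<tau> n" for n] choice[of "\<lambda>n x. orthonormal_on ?S x \<and>
        (\<forall>i\<in>?S. x i \<in> eigenspace V (A (\<tau> n)) (complex_of_real (l i (\<tau> n))))"] by blast
  define r where "r n i = 1 / (complex_of_real (l i (\<tau> n)) - \<i>)" for n i
  have Rx: "R (\<tau> n) (x n i) = r n i *\<^sub>C x n i" if "i \<in> ?S" for n i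
    using resolvent_eigenvalue[OF x(2)[OF that]] by (simp add: r_def)
  have l_lim: "(\<lambda>n. l i (\<tau> n)) \<longlonglongrightarrow> z" if "i \<in> ?S" for i
    using continuous_at[OF S(2)[OF that]] \<tau>(1) S(3)[OF that]
    by (metis continuous_on_tendsto_compose UNIV_I eventually_sequentiallyI)
  have r_lim: "(\<lambda>n. r n i) \<longlonglongrightarrow> \<rho>" if "i \<in> ?S" for i
    unfolding r_def \<rho>_def using l_lim[OF that] nz by (intro tendsto_intros)
  define Q where "Q n = (R (\<tau> n) - R t) /\<^sub>R (\<tau> n - t)" for n
  have Q_lim: "Q \<longlonglongrightarrow> R1"
    unfolding Q_def using \<tau> by (intro filterlim_compose[OF deriv]) (simp add: filterlim_at)
  have R_eq: "R (\<tau> n) f = R t f + (\<tau> n - t) *\<^sub>R Q n f" for n f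
    using \<tau>(2) by (simp add: Q_def blinfun.scaleR_left blinfun.diff_left)
  have "compact (closure (R t ` cball 0 1))"
    using compact_R[OF compact_resolvent_at] by (simp add: compact_operator_def)
  then have seq: "seq_compact (closure (R t ` cball 0 1))"
    by (rule compact_imp_seq_compact)
  have "\<exists>\<sigma>'. strict_mono \<sigma>' \<and> convergent (\<lambda>n. R t (x (\<sigma> (\<sigma>' n)) i))" if "i \<in> ?S" for i and \<sigma> :: "nat \<Rightarrow> nat"
  proof -
    have "R t (x (\<sigma> n) i) \<in> closure (R t ` cball 0 1)" for n
      using orthonormal_on_norm[OF x(1) that] closure_subset[of "R t ` cball 0 1"] by auto
    then obtain \<sigma>' u where "strict_mono \<sigma>'" "((\<lambda>n. R t (x (\<sigma> n) i)) \<circ> \<sigma>') \<longlonglongrightarrow> u"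
      using seq_compactE[OF seq, of "\<lambda>n. R t (x (\<sigma> n) i)"] by blast
    then show ?thesis
      by (intro exI[of _ \<sigma>']) (auto simp: convergent_def o_def)
  qed
  then obtain \<sigma> where \<sigma>: "strict_mono \<sigma>" "\<And>i. i \<in> ?S \<Longrightarrow> convergent (\<lambda>n. R t (x (\<sigma> n) i))"
    using common_convergent_subsequence[OF S(1), of "\<lambda>i n. R t (x n i)"] by blast
  note sub = LIMSEQ_subseq_LIMSEQ[OF _ \<sigma>(1), unfolded o_def]
  have Qx: "(\<lambda>n. (\<tau> (\<sigma> n) - t) *\<^sub>R Q (\<sigma> n) (x (\<sigma> n) i)) \<longlonglongrightarrow> 0" if "i \<in> ?S" for i
  proof (rule Lim_null_comparison)
    have "norm (Q n (x n i)) \<le> norm (Q n)" for n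
      using norm_blinfun[of "Q n" "x n i"] orthonormal_on_norm[OF x(1) that] by simp
    then show "\<forall>\<^sub>F n in sequentially. norm ((\<tau> (\<sigma> n) - t) *\<^sub>R Q (\<sigma> n) (x (\<sigma> n) i))
        \<le> \<bar>\<tau> (\<sigma> n) - t\<bar> * norm (Q (\<sigma> n))"
      by (intro always_eventually allI) (simp add: mult_left_mono)
    have "(\<lambda>n. \<bar>\<tau> (\<sigma> n) - t\<bar> * norm (Q (\<sigma> n))) \<longlonglongrightarrow> \<bar>t - t\<bar> * norm R1"
      by (intro tendsto_intros sub[OF \<tau>(1)] sub[OF Q_lim])
    then show "(\<lambda>n. \<bar>\<tau> (\<sigma> n) - t\<bar> * norm (Q (\<sigma> n))) \<longlonglongrightarrow> 0" by simp
  qed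
  have "convergent (\<lambda>n. x (\<sigma> n) i)" if "i \<in> ?S" for i
  proof -
    from \<sigma>(2)[OF that] obtain u where u: "(\<lambda>n. R t (x (\<sigma> n) i)) \<longlonglongrightarrow> u"
      by (auto simp: convergent_def)
    have "(\<lambda>n. (complex_of_real (l i (\<tau> (\<sigma> n))) - \<i>) *\<^sub>C
        (R t (x (\<sigma> n) i) + (\<tau> (\<sigma> n) - t) *\<^sub>R Q (\<sigma> n) (x (\<sigma> n) i)))
      \<longlonglongrightarrow> (complex_of_real z - \<i>) *\<^sub>C (u + 0)"
      by (intro scaleC.tendsto tendsto_intros sub[OF l_lim[OF that]] u Qx[OF that])
    moreover have "(complex_of_real (l i (\<tau> (\<sigma> n))) - \<i>) *\<^sub>C
        (R t (x (\<sigma> n) i) + (\<tau> (\<sigma> n) - t) *\<^sub>R Q (\<sigma> n) (x (\<sigma> n) i)) = x (\<sigma> n) i" for n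
      using nz by (simp only: R_eq[symmetric] Rx[OF that] scaleC_scaleC) (simp add: r_def)
    ultimately show ?thesis
      by (auto simp: convergent_def)
  qed
  then obtain e where e: "\<And>i. i \<in> ?S \<Longrightarrow> (\<lambda>n. x (\<sigma> n) i) \<longlonglongrightarrow> e i"
    unfolding convergent_def by metis
  have orth: "orthonormal_on ?S e"
    unfolding orthonormal_on_def
  proof (intro ballI)
    fix i j assume ij: "i \<in> ?S" "j \<in> ?S"
    have "(\<lambda>n. cinner (x (\<sigma> n) i) (x (\<sigma> n) j)) \<longlonglongrightarrow> cinner (e i) (e j)"
      by (intro cinner.tendsto e ij)
    then show "cinner (e i) (e j) = (if i = j then 1 else 0)"
      by (simp only: orthonormal_onD[OF x(1) ij] LIMSEQ_const_iff)
  qed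
  have e_eig: "e i \<in> eigenspace V (A t) (complex_of_real z)" if "i \<in> ?S" for i
  proof -
    have "(\<lambda>n. R (\<tau> (\<sigma> n)) (x (\<sigma> n) i) - (\<tau> (\<sigma> n) - t) *\<^sub>R Q (\<sigma> n) (x (\<sigma> n) i)) \<longlonglongrightarrow> \<rho> *\<^sub>C e i - 0"
      unfolding Rx[OF that]
      by (intro scaleC.tendsto tendsto_intros sub[OF r_lim[OF that]] e Qx that)
    then have "(\<lambda>n. R t (x (\<sigma> n) i)) \<longlonglongrightarrow> \<rho> *\<^sub>C e i"
      by (simp add: R_eq)
    moreover have "(\<lambda>n. R t (x (\<sigma> n) i)) \<longlonglongrightarrow> R t (e i)"
      by (intro blinfun.tendsto tendsto_const e that)
    ultimately have "R t (e i) = \<rho> *\<^sub>C e i"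
      by (rule LIMSEQ_unique[rotated])
    then show ?thesis
      by (simp add: eigenspace_iff_R \<rho>_def)
  qed
  have span: "cvec.span (e ` ?S) = eigenspace V (A t) (complex_of_real z)"
  proof -
    obtain B where B: "finite B" "card B = card ?S" "cvec.span B = eigenspace V (A t) (complex_of_real z)"
      using eigenspace_basis by blast
    then show ?thesis
      using orthonormal_on_spans[OF orth S(1), of B] e_eig by auto
  qed
  have Q_cinner: "cinner (Q n (x n i)) (e j) = (r n i - \<rho>) /\<^sub>R (\<tau> n - t) * cinner (x n i) (e j)"
    if "i \<in> ?S" "j \<in> ?S" for n i j
  proof -
    have "cinner (Q n (x n i)) (e j) = (cinner (R (\<tau> n) (x n i)) (e j) - cinner (R t (x n i)) (e j)) /\<^sub>R (\<tau> n - t)"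
      by (simp add: Q_def blinfun.scaleR_left blinfun.diff_left cinner_scaleR_left cinner.diff_left)
    also have "cinner (R t (x n i)) (e j) = \<rho> * cinner (x n i) (e j)"
      using cinner_R_eigenvector[OF e_eig[OF that(2)]] by (simp add: \<rho>_def)
    finally show ?thesis
      by (simp add: Rx[OF that(1)] cinner_scaleC_left left_diff_distrib)
  qed
  have Q_cinner_lim: "(\<lambda>n. cinner (Q (\<sigma> n) (x (\<sigma> n) i)) (e j)) \<longlonglongrightarrow> cinner (R1 (e i)) (e j)"
    if "i \<in> ?S" for i j
    by (intro cinner.tendsto blinfun.tendsto tendsto_const sub[OF Q_lim] e that)
  have x_cinner_lim: "(\<lambda>n. cinner (x (\<sigma> n) i) (e j)) \<longlonglongrightarrow> (if i = j then 1 else 0)"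
    if "i \<in> ?S" "j \<in> ?S" for i j
    using cinner.tendsto[OF e[OF that(1)] tendsto_const, of "e j"]
    by (simp add: orthonormal_onD[OF orth that])
  have r_quot_lim: "(\<lambda>n. (r (\<sigma> n) i - \<rho>) /\<^sub>R (\<tau> (\<sigma> n) - t)) \<longlonglongrightarrow> cinner (R1 (e i)) (e i)"
    if "i \<in> ?S" for i
  proof -
    have lim1: "(\<lambda>n. cinner (x (\<sigma> n) i) (e i)) \<longlonglongrightarrow> 1"
      using x_cinner_lim[OF that that] by simp
    have "(\<lambda>n. cinner (Q (\<sigma> n) (x (\<sigma> n) i)) (e i) / cinner (x (\<sigma> n) i) (e i))
        \<longlonglongrightarrow> cinner (R1 (e i)) (e i) / 1"
      by (intro tendsto_divide Q_cinner_lim lim1 that) simp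
    moreover have "\<forall>\<^sub>F n in sequentially. cinner (x (\<sigma> n) i) (e i) \<noteq> 0"
      using tendsto_imp_eventually_ne[OF lim1] by simp
    then have "\<forall>\<^sub>F n in sequentially. cinner (Q (\<sigma> n) (x (\<sigma> n) i)) (e i) / cinner (x (\<sigma> n) i) (e i)
        = (r (\<sigma> n) i - \<rho>) /\<^sub>R (\<tau> (\<sigma> n) - t)"
      by eventually_elim (simp add: Q_cinner[OF that that] scaleR_conv_of_real)
    ultimately show ?thesis
      using tendsto_cong by fastforce
  qed
  define \<mu> where "\<mu> i = - Re ((complex_of_real z - \<i>)\<^sup>2 * cinner (R1 (e i)) (e i))" for i
  have quot: "(\<lambda>n. complex_of_real ((l i (\<tau> (\<sigma> n)) - z) / (\<tau> (\<sigma> n) - t)))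
      \<longlonglongrightarrow> - ((complex_of_real z - \<i>)\<^sup>2 * cinner (R1 (e i)) (e i))" if "i \<in> ?S" for i
  proof -
    have "(\<lambda>n. - ((complex_of_real (l i (\<tau> (\<sigma> n))) - \<i>) * (complex_of_real z - \<i>)
        * ((r (\<sigma> n) i - \<rho>) /\<^sub>R (\<tau> (\<sigma> n) - t))))
      \<longlonglongrightarrow> - ((complex_of_real z - \<i>) * (complex_of_real z - \<i>) * cinner (R1 (e i)) (e i))"
      by (intro tendsto_minus tendsto_mult tendsto_diff tendsto_of_real tendsto_const
          sub[OF l_lim[OF that]] r_quot_lim that)
    moreover have "- ((complex_of_real (l i s) - \<i>) * (complex_of_real z - \<i>)
        * ((1 / (complex_of_real (l i s) - \<i>) - \<rho>) /\<^sub>R h)) = complex_of_real ((l i s - z) / h)" for s h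
      using nz[of "l i s"] nz[of z]
      by (simp add: \<rho>_def scaleR_conv_of_real divide_simps)
    ultimately show ?thesis
      by (simp add: r_def power2_eq_square)
  qed
  have \<mu>_lim: "(\<lambda>n. (l i (\<tau> (\<sigma> n)) - z) / (\<tau> (\<sigma> n) - t)) \<longlonglongrightarrow> \<mu> i" if "i \<in> ?S" for i
    using tendsto_Re[OF quot[OF that]] by (simp add: \<mu>_def)
  have diag: "(complex_of_real z - \<i>)\<^sup>2 * cinner (R1 (e i)) (e i) = - complex_of_real (\<mu> i)"
    if "i \<in> ?S" for i
    using LIMSEQ_unique[OF quot[OF that] tendsto_of_real[OF \<mu>_lim[OF that]]]
    by (metis minus_minus)
  have offdiag: "cinner (R1 (e i)) (e j) = 0" if "i \<in> ?S" "j \<in> ?S" "i \<noteq> j" for i j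
  proof -
    have "(\<lambda>n. (r (\<sigma> n) i - \<rho>) /\<^sub>R (\<tau> (\<sigma> n) - t) * cinner (x (\<sigma> n) i) (e j))
        \<longlonglongrightarrow> cinner (R1 (e i)) (e i) * 0"
      using x_cinner_lim[OF that(1,2)] that(3) by (intro tendsto_mult r_quot_lim that(1)) auto
    then show ?thesis
      using LIMSEQ_unique[OF Q_cinner_lim[OF that(1), of j]]
      by (simp add: Q_cinner[OF that(1,2)])
  qed
  have "diagonalizes t z R1 e \<mu>"
    using orth span diag offdiag by (simp add: diagonalizes_def)
  then show ?thesis
    using \<sigma>(1) \<mu>_lim S(3) by (intro exI[of _ \<sigma>] exI[of _ e] exI[of _ \<mu>]) auto
qed

lemma derivative_scaleC:
  assumes "((\<lambda>s. (R s - R t) /\<^sub>R (s - t)) \<longlongrightarrow> R1) (at t)"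
  shows "R1 (c *\<^sub>C x) = c *\<^sub>C R1 x"
proof -
  have lim: "((\<lambda>s. ((R s - R t) /\<^sub>R (s - t)) y) \<longlongrightarrow> R1 y) (at t)" for y
    by (intro blinfun.tendsto assms tendsto_const)
  have "((\<lambda>s. c *\<^sub>C ((R s - R t) /\<^sub>R (s - t)) x) \<longlongrightarrow> c *\<^sub>C R1 x) (at t)"
    by (intro scaleC.tendsto lim tendsto_const)
  moreover have "c *\<^sub>C ((R s - R t) /\<^sub>R (s - t)) x = ((R s - R t) /\<^sub>R (s - t)) (c *\<^sub>C x)" for s
    by (simp add: blinfun.scaleR_left blinfun.diff_left R_scaleC scaleC.scaleR_right
        cvec.scale_right_diff_distrib)
  ultimately show ?thesis
    using tendsto_unique[OF _ lim[of "c *\<^sub>C x"]] by simp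
qed

text \<open>
  Expanding \<open>e i\<close> in the basis \<open>e'\<close>, or \<open>e' j\<close> in the basis \<open>e\<close>, evaluates \<open>\<langle>R1 (e i), e' j\<rangle>\<close> in two
  ways, as a fixed multiple of \<open>\<mu>' j\<close> or of \<open>\<mu> i\<close> times the overlap of the two vectors.
\<close>

lemma diagonalizes_overlap:
  assumes deriv: "((\<lambda>s. (R s - R t) /\<^sub>R (s - t)) \<longlongrightarrow> R1) (at t)"
    and e: "diagonalizes t z R1 e \<mu>" and e': "diagonalizes t z R1 e' \<mu>'"
    and ij: "i \<in> level t z" "j \<in> level t z" "cinner (e i) (e' j) \<noteq> 0"
  shows "\<mu> i = \<mu>' j"
proof -
  let ?S = "level t z" and ?\<kappa> = "(complex_of_real z - \<i>)\<^sup>2"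
  note D = e[unfolded diagonalizes_def] and D' = e'[unfolded diagonalizes_def]
  have "e i \<in> cvec.span (e' ` ?S)" "e' j \<in> cvec.span (e ` ?S)"
    using D D' ij by (metis cvec.span_base imageI)+
  then have exp: "e i = (\<Sum>k\<in>?S. cinner (e i) (e' k) *\<^sub>C e' k)"
      "e' j = (\<Sum>k\<in>?S. cinner (e' j) (e k) *\<^sub>C e k)"
    using D D' orthonormal_on_expansion finite_level by blast+
  have "?\<kappa> * cinner (R1 (e i)) (e' j)
      = ?\<kappa> * cinner (R1 (\<Sum>k\<in>?S. cinner (e i) (e' k) *\<^sub>C e' k)) (e' j)"
    using exp(1) by simp
  also have "\<dots> = (\<Sum>k\<in>?S. cinner (e i) (e' k) * (?\<kappa> * cinner (R1 (e' k)) (e' j)))"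
    by (simp add: blinfun.sum_right cinner.sum_left derivative_scaleC[OF deriv] cinner_scaleC_left
        sum_distrib_left mult_ac)
  also have "\<dots> = (\<Sum>k\<in>?S. if k = j then - cinner (e i) (e' j) * complex_of_real (\<mu>' j) else 0)"
    using D' ij(2) by (intro sum.cong) auto
  also have "\<dots> = - cinner (e i) (e' j) * complex_of_real (\<mu>' j)"
    using ij(2) finite_level by simp
  finally have eq: "?\<kappa> * cinner (R1 (e i)) (e' j) = - cinner (e i) (e' j) * complex_of_real (\<mu>' j)" .
  have "?\<kappa> * cinner (R1 (e i)) (e' j)
      = ?\<kappa> * cinner (R1 (e i)) (\<Sum>k\<in>?S. cinner (e' j) (e k) *\<^sub>C e k)"
    using exp(2) by simp
  also have "\<dots> = (\<Sum>k\<in>?S. cinner (e k) (e' j) * (?\<kappa> * cinner (R1 (e i)) (e k)))"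
    by (simp add: cinner.sum_right cinner_scaleC_right sum_distrib_left mult_ac
        flip: cinner_commute)
  also have "\<dots> = (\<Sum>k\<in>?S. if k = i then - cinner (e i) (e' j) * complex_of_real (\<mu> i) else 0)"
    using D ij(1) by (intro sum.cong) auto
  also have "\<dots> = - cinner (e i) (e' j) * complex_of_real (\<mu> i)"
    using ij(1) finite_level by simp
  finally show ?thesis
    using eq ij(3) by simp
qed

lemma diagonalizes_expansion:
  assumes deriv: "((\<lambda>s. (R s - R t) /\<^sub>R (s - t)) \<longlongrightarrow> R1) (at t)"
    and e: "diagonalizes t z R1 e \<mu>" and e': "diagonalizes t z R1 e' \<mu>'" and i: "i \<in> level t z"
  shows "e i \<in> cvec.span (e' ` {j \<in> level t z. \<mu>' j = \<mu> i})"
proof -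
  let ?S = "level t z"
  note D = e[unfolded diagonalizes_def] and D' = e'[unfolded diagonalizes_def]
  have "e i \<in> cvec.span (e' ` ?S)"
    using D D' i by (metis cvec.span_base imageI)
  then have "e i = (\<Sum>k\<in>?S. cinner (e i) (e' k) *\<^sub>C e' k)"
    using D D' orthonormal_on_expansion finite_level by blast
  also have "\<dots> \<in> cvec.span (e' ` {j \<in> ?S. \<mu>' j = \<mu> i})"
  proof (rule cvec.span_sum)
    fix k assume k: "k \<in> ?S"
    show "cinner (e i) (e' k) *\<^sub>C e' k \<in> cvec.span (e' ` {j \<in> ?S. \<mu>' j = \<mu> i})"
    proof (cases "cinner (e i) (e' k) = 0")
      case False
      then have "\<mu>' k = \<mu> i"
        using diagonalizes_overlap[OF deriv e e' i k] by simp
      then show ?thesis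
        using k by (intro cvec.span_scale cvec.span_base imageI) simp
    qed (simp add: cvec.span_zero)
  qed
  finally show ?thesis .
qed

text \<open>
  By symmetry equality holds: the multiset of diagonal entries depends only on \<open>R1\<close>, and not on the
  sequence of parameters from which the basis arose. This is why the two one-sided derivatives
  agree with multiplicity.
\<close>

lemma diagonalizes_card_le:
  assumes deriv: "((\<lambda>s. (R s - R t) /\<^sub>R (s - t)) \<longlongrightarrow> R1) (at t)"
    and e: "diagonalizes t z R1 e \<mu>" and e': "diagonalizes t z R1 e' \<mu>'"
  shows "card {i \<in> level t z. \<mu> i = c} \<le> card {i \<in> level t z. \<mu>' i = c}"
proof -
  let ?I = "{i \<in> level t z. \<mu> i = c}" and ?J = "{i \<in> level t z. \<mu>' i = c}"
  have orth: "orthonormal_on ?I e"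
    using e by (auto simp: diagonalizes_def intro: orthonormal_on_subset)
  have "e ` ?I \<subseteq> cvec.span (e' ` ?J)"
    using diagonalizes_expansion[OF deriv e e'] by auto
  then have "card (e ` ?I) \<le> card (e' ` ?J)"
    using cvec.independent_span_bound[of "e' ` ?J" "e ` ?I"] orthonormal_on_independent[OF orth]
      finite_level by simp
  also have "\<dots> \<le> card ?J"
    using finite_level by (intro card_image_le) simp
  finally show ?thesis
    by (simp add: card_image orthonormal_on_inj[OF orth])
qed

lemma diagonalizes_value_mem:
  assumes deriv: "((\<lambda>s. (R s - R t) /\<^sub>R (s - t)) \<longlongrightarrow> R1) (at t)"
    and e: "diagonalizes t z R1 e \<mu>" and e': "diagonalizes t z R1 e' \<mu>'" and i: "i \<in> level t z"
  shows "\<mu> i \<in> \<mu>' ` level t z"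
proof -
  have "e i \<noteq> 0"
    using e i orthonormal_on_norm[of "level t z" e i] by (auto simp: diagonalizes_def)
  then have "{j \<in> level t z. \<mu>' j = \<mu> i} \<noteq> {}"
    using diagonalizes_expansion[OF deriv e e' i] by (metis cvec.span_empty image_is_empty singletonD)
  then show ?thesis by force
qed

end

section \<open>One-sided derivatives\<close>

text \<open>
  Otherwise \<open>f\<close> takes any fixed value \<open>c\<close> between \<open>p\<close> and \<open>q\<close> at points between \<open>a n\<close> and \<open>b n\<close>, so
  that \<open>c\<close> is a cluster value itself; but \<open>c\<close> can be chosen outside the finite set \<open>F\<close>.
\<close>

lemma cluster_value_unique:
  fixes f :: "real \<Rightarrow> real"
  assumes U: "convex U" "continuous_on U f" and F: "finite F"
    and cluster: "\<And>\<tau>. (\<And>n::nat. \<tau> n \<in> U) \<Longrightarrow> \<tau> \<longlonglongrightarrow> t \<Longrightarrow>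
      \<exists>\<sigma> c. strict_mono \<sigma> \<and> c \<in> F \<and> (\<lambda>n. f (\<tau> (\<sigma> n))) \<longlonglongrightarrow> c"
    and a: "\<And>n. a n \<in> U" "a \<longlonglongrightarrow> t" "(\<lambda>n. f (a n)) \<longlonglongrightarrow> p"
    and b: "\<And>n. b n \<in> U" "b \<longlonglongrightarrow> t" "(\<lambda>n. f (b n)) \<longlonglongrightarrow> q"
  shows "q \<le> p"
proof (rule ccontr)
  assume "\<not> q \<le> p"
  then have "infinite {p<..<q}" by (simp add: infinite_Ioo)
  then obtain c where c: "p < c" "c < q" "c \<notin> F"
    using finite_subset[OF _ F, of "{p<..<q}"] by fastforce
  have "\<forall>\<^sub>F n in sequentially. f (a n) < c \<and> c < f (b n)"
    using order_tendstoD(2)[OF a(3) c(1)] order_tendstoD(1)[OF b(3) c(2)]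
    by (rule eventually_conj)
  then obtain M where M: "\<And>n. n \<ge> M \<Longrightarrow> f (a n) < c \<and> c < f (b n)"
    by (auto simp: eventually_sequentially)
  have "\<exists>s\<in>closed_segment (a (n + M)) (b (n + M)). f s = c" for n
  proof -
    let ?I = "closed_segment (a (n + M)) (b (n + M))"
    have "?I \<subseteq> U"
      using U(1) a(1) b(1) by (simp add: closed_segment_subset)
    then have "connected (f ` ?I)"
      using U(2) by (intro connected_continuous_image) (auto intro: continuous_on_subset)
    then have "c \<in> f ` ?I"
      using M[of "n + M"] connectedD_interval[of "f ` ?I" "f (a (n + M))" "f (b (n + M))" c] by auto
    then show ?thesis by auto
  qed
  then obtain s where s: "\<And>n. s n \<in> closed_segment (a (n + M)) (b (n + M))" "\<And>n. f (s n) = c"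
    by metis
  have "s n \<in> U" for n
    using s(1)[of n] closed_segment_subset[OF a(1) b(1) U(1)] by blast
  moreover have "s \<longlonglongrightarrow> t"
  proof (rule LIM_zero_cancel, rule Lim_null_comparison)
    show "\<forall>\<^sub>F n in sequentially. norm (s n - t) \<le> \<bar>a (n + M) - t\<bar> + \<bar>b (n + M) - t\<bar>"
      using s(1) by (intro always_eventually allI)
        (smt (verit) atLeastAtMost_iff closed_segment_eq_real_ivl real_norm_def)
    have "(\<lambda>n. \<bar>a (n + M) - t\<bar> + \<bar>b (n + M) - t\<bar>) \<longlonglongrightarrow> \<bar>t - t\<bar> + \<bar>t - t\<bar>"
      by (intro tendsto_intros LIMSEQ_ignore_initial_segment a(2) b(2))
    then show "(\<lambda>n. \<bar>a (n + M) - t\<bar> + \<bar>b (n + M) - t\<bar>) \<longlonglongrightarrow> 0" by simp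
  qed
  ultimately obtain \<sigma> d where "d \<in> F" "(\<lambda>n. f (s (\<sigma> n))) \<longlonglongrightarrow> d"
    using cluster by blast
  then show False
    using c(3) by (simp add: s(2) LIMSEQ_const_iff)
qed

lemma tendsto_if_finitely_many_cluster_values:
  fixes f :: "real \<Rightarrow> real"
  assumes U: "convex U" "continuous_on U f" "t \<notin> U" and F: "finite F"
    and cluster: "\<And>\<tau>. (\<And>n::nat. \<tau> n \<in> U) \<Longrightarrow> \<tau> \<longlonglongrightarrow> t \<Longrightarrow>
      \<exists>\<sigma> c. strict_mono \<sigma> \<and> c \<in> F \<and> (\<lambda>n. f (\<tau> (\<sigma> n))) \<longlonglongrightarrow> c"
  shows "\<exists>L. (f \<longlongrightarrow> L) (at t within U)"
proof (cases "t islimpt U")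
  case False
  then have "at t within U = bot"
    by (simp add: trivial_limit_within)
  then show ?thesis by simp
next
  case True
  then obtain \<tau>0 where \<tau>0: "\<And>n::nat. \<tau>0 n \<in> U" "\<tau>0 \<longlonglongrightarrow> t"
    unfolding islimpt_sequential by blast
  obtain \<sigma>0 L where \<sigma>0: "strict_mono \<sigma>0" "L \<in> F" "(\<lambda>n. f (\<tau>0 (\<sigma>0 n))) \<longlonglongrightarrow> L"
    using cluster[OF \<tau>0] by blast
  have sub: "(\<lambda>n. \<tau> (\<sigma> n)) \<longlonglongrightarrow> t" if "\<tau> \<longlonglongrightarrow> t" "strict_mono \<sigma>" for \<tau> and \<sigma> :: "nat \<Rightarrow> nat"
    using LIMSEQ_subseq_LIMSEQ[OF that] by (simp add: o_def)
  have "(f \<circ> X) \<longlonglongrightarrow> L" if X: "\<forall>n. X n \<in> U - {t}" "X \<longlonglongrightarrow> t" for X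
  proof (rule ccontr)
    assume "\<not> (f \<circ> X) \<longlonglongrightarrow> L"
    then obtain \<epsilon> where \<epsilon>: "\<epsilon> > 0" "\<not> (\<forall>\<^sub>F n in sequentially. dist (f (X n)) L < \<epsilon>)"
      by (auto simp: tendsto_iff)
    then obtain \<sigma>1 :: "nat \<Rightarrow> nat" where \<sigma>1: "strict_mono \<sigma>1" "\<And>n. \<not> dist (f (X (\<sigma>1 n))) L < \<epsilon>"
      using not_eventually_sequentiallyD by blast
    obtain \<sigma>2 c where \<sigma>2: "strict_mono \<sigma>2" "(\<lambda>n. f (X (\<sigma>1 (\<sigma>2 n)))) \<longlonglongrightarrow> c"
      using cluster[of "\<lambda>n. X (\<sigma>1 n)"] X(1) sub[OF X(2) \<sigma>1(1)] by blast
    have lim0: "(\<lambda>n. \<tau>0 (\<sigma>0 n)) \<longlonglongrightarrow> t" and lim1: "(\<lambda>n. X (\<sigma>1 (\<sigma>2 n))) \<longlonglongrightarrow> t"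
      using sub[OF \<tau>0(2) \<sigma>0(1)] sub[OF sub[OF X(2) \<sigma>1(1)] \<sigma>2(1)] by blast+
    have mem: "X n \<in> U" for n
      using X(1) by blast
    have "c \<le> L"
      by (rule cluster_value_unique[OF U(1,2) F _ \<tau>0(1) lim0 \<sigma>0(3) mem lim1 \<sigma>2(2)])
        (rule cluster)
    moreover have "L \<le> c"
      by (rule cluster_value_unique[OF U(1,2) F _ mem lim1 \<sigma>2(2) \<tau>0(1) lim0 \<sigma>0(3)])
        (rule cluster)
    ultimately have "c = L" by simp
    then show False
      using \<sigma>1(2) \<sigma>2(2) \<epsilon>(1) by (auto simp: tendsto_iff eventually_sequentially)
  qed
  then show ?thesis
    by (auto simp: tendsto_at_iff_sequentially)
qed

context eigenvalue_curves
begin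

lemma diagonalization_exists:
  assumes deriv: "((\<lambda>s. (R s - R t) /\<^sub>R (s - t)) \<longlongrightarrow> R1) (at t)"
  shows "\<exists>e \<mu>. diagonalizes t z R1 e \<mu>"
proof -
  have "(\<lambda>n. t + inverse (real (Suc n))) \<longlonglongrightarrow> t"
    by (rule LIMSEQ_inverse_real_of_nat_add)
  then show ?thesis
    using eigenvalue_quotients_subsequence[OF deriv, of "\<lambda>n. t + inverse (real (Suc n))" z] by auto
qed

lemma one_sided_derivative_exists:
  assumes deriv: "((\<lambda>s. (R s - R t) /\<^sub>R (s - t)) \<longlongrightarrow> R1) (at t)"
    and i: "enat i < N" and U: "convex U" "t \<notin> U"
  shows "\<exists>D. (l i has_real_derivative D) (at t within U)"
proof -
  obtain e \<mu> where e: "diagonalizes t (l i t) R1 e \<mu>"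
    using diagonalization_exists[OF deriv] by blast
  have lev: "i \<in> level t (l i t)"
    using i by (simp add: level_def)
  have "\<exists>D. ((\<lambda>s. (l i s - l i t) / (s - t)) \<longlongrightarrow> D) (at t within U)"
  proof (rule tendsto_if_finitely_many_cluster_values)
    show "finite (\<mu> ` level t (l i t))"
      by (intro finite_imageI finite_level)
    show "continuous_on U (\<lambda>s. (l i s - l i t) / (s - t))"
      using U(2) continuous_on_subset[OF continuous_at[OF i], of U]
      by (intro continuous_intros) auto
    fix \<tau> :: "nat \<Rightarrow> real" assume \<tau>: "\<And>n. \<tau> n \<in> U" "\<tau> \<longlonglongrightarrow> t"
    have ne: "\<tau> n \<noteq> t" for n
      using \<tau>(1) U(2) by metis
    obtain \<sigma> e' \<mu>' where *: "strict_mono \<sigma>" "diagonalizes t (l i t) R1 e' \<mu>'"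
        "\<forall>j\<in>level t (l i t). (\<lambda>n. (l j (\<tau> (\<sigma> n)) - l j t) / (\<tau> (\<sigma> n) - t)) \<longlonglongrightarrow> \<mu>' j"
      using eigenvalue_quotients_subsequence[OF deriv \<tau>(2) ne] by blast
    then show "\<exists>\<sigma> c. strict_mono \<sigma> \<and> c \<in> \<mu> ` level t (l i t) \<and>
        (\<lambda>n. (l i (\<tau> (\<sigma> n)) - l i t) / (\<tau> (\<sigma> n) - t)) \<longlonglongrightarrow> c"
      using diagonalizes_value_mem[OF deriv *(2) e lev] lev by blast
  qed (use U in auto)
  then show ?thesis
    by (simp add: has_field_derivative_iff)
qed

text \<open>
  Along a sequence that approaches from the side of \<open>U\<close>, the difference quotients converge to the
  one-sided derivatives, hence those are the diagonal entries in some diagonalizing basis.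
\<close>

lemma one_sided_derivatives_diagonalize:
  assumes deriv: "((\<lambda>s. (R s - R t) /\<^sub>R (s - t)) \<longlongrightarrow> R1) (at t)"
    and D: "\<And>i. enat i < N \<Longrightarrow> (l i has_real_derivative D i) (at t within U)"
    and U: "t islimpt U"
  shows "\<exists>e. diagonalizes t z R1 e D"
proof -
  obtain \<tau> where \<tau>: "\<And>n::nat. \<tau> n \<in> U - {t}" "\<tau> \<longlonglongrightarrow> t"
    using U unfolding islimpt_sequential by blast
  obtain \<sigma> e \<mu> where *: "strict_mono \<sigma>" "diagonalizes t z R1 e \<mu>"
      "\<And>i. i \<in> level t z \<Longrightarrow> (\<lambda>n. (l i (\<tau> (\<sigma> n)) - l i t) / (\<tau> (\<sigma> n) - t)) \<longlonglongrightarrow> \<mu> i"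
    using eigenvalue_quotients_subsequence[OF deriv \<tau>(2), of z] \<tau>(1) by blast
  have "\<mu> i = D i" if i: "i \<in> level t z" for i
  proof -
    have "((\<lambda>s. (l i s - l i t) / (s - t)) \<longlongrightarrow> D i) (at t within U)"
      using D[of i] i by (simp add: level_def has_field_derivative_iff)
    then have "((\<lambda>s. (l i s - l i t) / (s - t)) \<circ> \<tau>) \<longlonglongrightarrow> D i"
      using \<tau> unfolding tendsto_at_iff_sequentially by blast
    then have "(\<lambda>n. (l i (\<tau> (\<sigma> n)) - l i t) / (\<tau> (\<sigma> n) - t)) \<longlonglongrightarrow> D i"
      using LIMSEQ_subseq_LIMSEQ[OF _ *(1)] by (force simp: o_def)
    then show ?thesis
      using *(3)[OF i] LIMSEQ_unique by blast
  qed
  then have "diagonalizes t z R1 e D"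
    using *(2) unfolding diagonalizes_def by auto
  then show ?thesis by blast
qed

lemma one_sided_derivatives:
  assumes diff: "\<And>t. \<exists>R1. ((\<lambda>s. (R s - R t) /\<^sub>R (s - t)) \<longlongrightarrow> R1) (at t)"
  shows "\<exists>lp lm :: nat \<Rightarrow> real \<Rightarrow> real.
    (\<forall>i t. enat i < N \<longrightarrow>
      (l i has_real_derivative lp i t) (at_right t) \<and>
      (l i has_real_derivative lm i t) (at_left t)) \<and>
    (\<forall>t z. same_multiset_on {i. enat i < N \<and> l i t = z} (\<lambda>i. lp i t) (\<lambda>i. lm i t))"
proof -
  have "\<exists>p. enat i < N \<longrightarrow> (l i has_real_derivative p) (at_right t)" for i t
    using diff one_sided_derivative_exists[of t _ i "{t<..}"] by auto
  then obtain lp where lp: "\<And>i t. enat i < N \<Longrightarrow> (l i has_real_derivative lp i t) (at_right t)"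
    by metis
  have "\<exists>p. enat i < N \<longrightarrow> (l i has_real_derivative p) (at_left t)" for i t
    using diff one_sided_derivative_exists[of t _ i "{..<t}"] by auto
  then obtain lm where lm: "\<And>i t. enat i < N \<Longrightarrow> (l i has_real_derivative lm i t) (at_left t)"
    by metis
  have "same_multiset_on (level t z) (\<lambda>i. lp i t) (\<lambda>i. lm i t)" for t z
  proof -
    obtain R1 where deriv: "((\<lambda>s. (R s - R t) /\<^sub>R (s - t)) \<longlongrightarrow> R1) (at t)"
      using diff by blast
    have "t islimpt {t<..}" "t islimpt {..<t}"
      using trivial_limit_within[of t "{t<..}"] trivial_limit_within[of t "{..<t}"] by simp_all
    then obtain e e' where e: "diagonalizes t z R1 e (\<lambda>i. lp i t)" "diagonalizes t z R1 e' (\<lambda>i. lm i t)"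
      using one_sided_derivatives_diagonalize[OF deriv, of "\<lambda>i. lp i t" "{t<..}" z] lp
        one_sided_derivatives_diagonalize[OF deriv, of "\<lambda>i. lm i t" "{..<t}" z] lm by blast
    have "card {i \<in> level t z. lp i t = c} = card {i \<in> level t z. lm i t = c}" for c
      using diagonalizes_card_le[OF deriv e(1,2)] diagonalizes_card_le[OF deriv e(2,1)]
      by (simp add: le_antisym)
    then show ?thesis
      using finite_level by (simp add: same_multiset_on_def eqpoll_iff_card)
  qed
  then show ?thesis
    using lp lm by (intro exI[of _ lp] exI[of _ lm]) (simp add: level_def)
qed

end

theorem mainTheorem4:
  fixes V :: "'a::complex_hilbert_space set"
    and A :: "real \<Rightarrow> 'a \<Rightarrow> 'a"
    and N :: enat
    and l :: "nat \<Rightarrow> real \<Rightarrow> real"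
  assumes self_adjoint: "\<And>t. self_adjoint_operator V (A t)"
    and compact_resolvent: "\<And>t. has_compact_resolvent V (A t)"
    and regular: "(\<exists>\<alpha>>0. C1_Holder_curve \<alpha> V A) \<or> C1_resolvent V A"
    and continuous: "\<And>i. enat i < N \<Longrightarrow> continuous_on UNIV (l i)"
    and eigenvalues: "parameterizes_eigenvalues N l V A"
  shows "\<exists>lp lm :: nat \<Rightarrow> real \<Rightarrow> real.
    (\<forall>i t. enat i < N \<longrightarrow>
      (l i has_real_derivative lp i t) (at_right t) \<and>
      (l i has_real_derivative lm i t) (at_left t)) \<and>
    (\<forall>t z. same_multiset_on {i. enat i < N \<and> l i t = z} (\<lambda>i. lp i t) (\<lambda>i. lm i t))"
proof -
  have sa: "self_adjoint V (A t)" for t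
    using self_adjoint by unfold_locales
  interpret eigenvalue_curves V A N l
    using sa compact_resolvent continuous eigenvalues by unfold_locales (auto simp: self_adjoint_def)
  show ?thesis
    using regular sa C1_Holder_curve_resolvent_differentiable[of V A]
      C1_resolvent_differentiable[of V A]
    by (intro one_sided_derivatives) blast
qed

end
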